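(* Let $N\ge 3$ be odd, let $V$ be an $N$-dimensional real vector space with a Lorentz-signature inner product $\eta_{ab}$, and let $K_{ab}=-K_{ba}$ be a bivector on $V$. Let $K^a{}_b$ be the corresponding skew-symmetric linear transformation of $V$ (obtained by raising the first index with $\eta$), and write its characteristic polynomial as $$\det(\lambda\,\delta^a{}_b-K^a{}_b)=\lambda^N-\sigma_1\lambda^{N-1}+\dots+\sigma_{N-1}\lambda,$$ so that $\sigma_{N-1}$ is the $(N-1)$-st elementary symmetric polynomial of the eigenvalues of $K^a{}_b$ (the constant term vanishes since $N$ is odd). Then the bivector alignment equations for $K_{ab}$ admit a real zero in the real extended space of null directions (that is, there exists a non-zero null vector $k\in V$ whose null direction $[k]$ is aligned with $K_{ab}$) if and only if $\sigma_{N-1}\leq 0$.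
   Context: Lorentz signature means signature $(N-1,1)$, with $\eta(u,u)<0$ for time-like and $\eta(u,u)>0$ for space-like $u$. A null frame is a basis $\ell=m_0$, $n=m_1$, $m_2,\dots,m_{N-1}$ of $V$ with $\eta(\ell,n)=1$, $\eta(m_i,m_i)=1$ for $i=2,\dots,N-1$, and all other products zero. Components with respect to a null frame are $K_{AB}=K(m_A,m_B)$. A null vector is a vector $k$ with $\eta(k,k)=0$; a null direction $[k]$ is the span of a non-zero null vector. A null direction $[k]$ is aligned with $K$ if $K_{0i}=0$ for all $2\le i\le N-1$ in a null frame with $\ell$ a scalar multiple of $k$ (this is independent of the choice of such a frame). Fixing a null frame, the bivector alignment equations are $p_{0j}(z)=0$, $j=2,\dots,N-1$, where (space-like indices raised and lowered trivially, repeated indices summed over $2,\dots,N-1$) $$p_{0j}(z)=K_{0j}+z^iK_{ij}-z_jK_{01}-\tfrac12 z^iz_i\,K_{1j}-z^iz_j\,K_{i1}.$$ A point $z\in\mathbb{R}^{N-2}$ corresponds to the null direction spanned by $\ell+z^im_i-\tfrac12 z^iz_i\,n$, and this direction is aligned with $K$ iff $z$ solves these equations. The real extended space $\mathbb{R}^{N-2}\cup\{\infty\}$, with $\infty$ corresponding to $[n]$, is thereby identified with the set of all real null directions, and a real zero of the alignment equations means an aligned null direction in this extended space. *)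

theory Defs
  imports "HOL-Analysis.Linear_Algebra" "Jordan_Normal_Form.Char_Poly"
begin

definition ordered_basis :: "nat \<Rightarrow> (nat \<Rightarrow> 'v::real_vector) \<Rightarrow> bool" where
  "ordered_basis N e \<longleftrightarrow>
     inj_on e {..<N} \<and> independent (e ` {..<N}) \<and> span (e ` {..<N}) = UNIV"

(* Signature (N-1,1): bilinear and symmetric, and diagonal with entries -1,1,...,1 in some basis. *)
definition lorentz_form :: "nat \<Rightarrow> ('v::real_vector \<Rightarrow> 'v \<Rightarrow> real) \<Rightarrow> bool" where
  "lorentz_form N \<eta> \<longleftrightarrow>
     bilinear \<eta> \<and> (\<forall>u v. \<eta> u v = \<eta> v u) \<and>
     (\<exists>e. ordered_basis N e \<and>
        (\<forall>i<N. \<forall>j<N. \<eta> (e i) (e j) = (if i \<noteq> j then 0 else if i = 0 then - 1 else 1)))"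

definition bivector :: "('v::real_vector \<Rightarrow> 'v \<Rightarrow> real) \<Rightarrow> bool" where
  "bivector K \<longleftrightarrow> bilinear K \<and> (\<forall>u v. K u v = - K v u)"

(* The transformation with components K^a_b = \<eta>^{ac} K_{cb}, characterised by
   \<eta>(u, K v) = K(u, v) for all u. *)
definition raise_first ::
  "('v::real_vector \<Rightarrow> 'v \<Rightarrow> real) \<Rightarrow> ('v \<Rightarrow> 'v \<Rightarrow> real) \<Rightarrow> 'v \<Rightarrow> 'v" where
  "raise_first \<eta> K v = (THE w. \<forall>u. \<eta> u w = K u v)"

(* Column j of the matrix holds the e-coordinates of T (e j). *)
definition matrix_in_basis ::
  "nat \<Rightarrow> (nat \<Rightarrow> 'v::real_vector) \<Rightarrow> ('v \<Rightarrow> 'v) \<Rightarrow> real mat" where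
  "matrix_in_basis N e T = mat N N (\<lambda>(i, j). representation (e ` {..<N}) (T (e j)) (e i))"

(* The choice of basis is immaterial for linear T; see char_poly_lin_eq below. *)
definition char_poly_lin :: "nat \<Rightarrow> ('v::real_vector \<Rightarrow> 'v) \<Rightarrow> real poly" where
  "char_poly_lin N T = char_poly (matrix_in_basis N (SOME e. ordered_basis N e) T)"

(* det(x - T) = x^N - \<sigma>_1 x^(N-1) + \<sigma>_2 x^(N-2) - ... *)
definition char_sigma :: "nat \<Rightarrow> ('v::real_vector \<Rightarrow> 'v) \<Rightarrow> nat \<Rightarrow> real" where
  "char_sigma N T k = (- 1) ^ k * coeff (char_poly_lin N T) (N - k)"

(* m 0 = l, m 1 = n, and m 2, ..., m (N-1) are the space-like frame vectors. *)
definition null_frame ::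
  "nat \<Rightarrow> ('v::real_vector \<Rightarrow> 'v \<Rightarrow> real) \<Rightarrow> (nat \<Rightarrow> 'v) \<Rightarrow> bool" where
  "null_frame N \<eta> m \<longleftrightarrow> ordered_basis N m \<and>
     (\<forall>A<N. \<forall>B<N. \<eta> (m A) (m B) =
        (if (A, B) \<in> {(0, 1), (1, 0)} \<or> (A = B \<and> 2 \<le> A) then 1 else 0))"

definition aligned ::
  "nat \<Rightarrow> ('v::real_vector \<Rightarrow> 'v \<Rightarrow> real) \<Rightarrow> ('v \<Rightarrow> 'v \<Rightarrow> real) \<Rightarrow> 'v set \<Rightarrow> bool" where
  "aligned N \<eta> K D \<longleftrightarrow>
     (\<exists>m. null_frame N \<eta> m \<and> m 0 \<in> D \<and> (\<forall>i\<in>{2..<N}. K (m 0) (m i) = 0))"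

(* The polynomial p_{0j}; a point z of R^(N-2) is a function of which only the values
   z 2, ..., z (N-1) are used. *)
definition alignment_poly ::
  "nat \<Rightarrow> ('v::real_vector \<Rightarrow> 'v \<Rightarrow> real) \<Rightarrow> (nat \<Rightarrow> 'v) \<Rightarrow> nat \<Rightarrow> (nat \<Rightarrow> real) \<Rightarrow> real" where
  "alignment_poly N K m j z =
     K (m 0) (m j) + (\<Sum>i=2..<N. z i * K (m i) (m j)) - z j * K (m 0) (m 1)
     - 1 / 2 * (\<Sum>i=2..<N. z i * z i) * K (m 1) (m j)
     - (\<Sum>i=2..<N. z i * z j * K (m i) (m 1))"

(* Points of the extended space: Some z is finite, None is the point at infinity. The equations
   have no value at infinity; a zero there means by convention that [n] is aligned. *)
definition alignment_zero ::
  "nat \<Rightarrow> ('v::real_vector \<Rightarrow> 'v \<Rightarrow> real) \<Rightarrow> ('v \<Rightarrow> 'v \<Rightarrow> real) \<Rightarrow> (nat \<Rightarrow> 'v) \<Rightarrow>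
     (nat \<Rightarrow> real) option \<Rightarrow> bool" where
  "alignment_zero N \<eta> K m \<zeta> \<longleftrightarrow>
     (case \<zeta> of
        Some z \<Rightarrow> \<forall>j\<in>{2..<N}. alignment_poly N K m j z = 0
      | None \<Rightarrow> aligned N \<eta> K (span {m 1}))"

text \<open>Well-definedness of the characteristic polynomial and of the raised transformation\<close>

lemma representation_linear_expand:
  fixes b c :: "nat \<Rightarrow> 'v::real_vector"
  assumes b: "ordered_basis N b" and c: "ordered_basis N c" and T: "linear T"
  shows "representation (c ` {..<N}) (T v) (c i) =
    (\<Sum>k<N. representation (c ` {..<N}) (T (b k)) (c i) * representation (b ` {..<N}) v (b k))"
proof -
  have ib: "independent (b ` {..<N})" "inj_on b {..<N}" "span (b ` {..<N}) = UNIV"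
    and ic: "independent (c ` {..<N})" "span (c ` {..<N}) = UNIV"
    using b c by (auto simp: ordered_basis_def)
  have "v = (\<Sum>x\<in>b ` {..<N}. representation (b ` {..<N}) v x *\<^sub>R x)"
    by (rule real_vector.sum_representation_eq[symmetric]) (use ib in auto)
  also have "\<dots> = (\<Sum>k<N. representation (b ` {..<N}) v (b k) *\<^sub>R b k)"
    by (simp add: sum.reindex[OF ib(2)])
  finally have "T v = T (\<Sum>k<N. representation (b ` {..<N}) v (b k) *\<^sub>R b k)" by simp
  also have "\<dots> = (\<Sum>k<N. representation (b ` {..<N}) v (b k) *\<^sub>R T (b k))"
    using T by (simp add: linear_sum linear_scale)
  finally show ?thesis
    by (simp add: real_vector.representation_sum real_vector.representation_scale ic mult.commute)
qed

lemma char_poly_lin_eq: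
  fixes e :: "nat \<Rightarrow> 'v::real_vector"
  assumes e: "ordered_basis N e" and T: "linear T"
  shows "char_poly_lin N T = char_poly (matrix_in_basis N e T)"
proof -
  define f :: "nat \<Rightarrow> 'v" where "f = (SOME e. ordered_basis N e)"
  have f: "ordered_basis N f" unfolding f_def by (rule someI[of _ e]) fact
  define M where "M b c S = mat N N (\<lambda>(i, j). representation (c ` {..<N}) (S (b j)) (c i))"
    for b c :: "nat \<Rightarrow> 'v" and S
  have M: "M b c S \<in> carrier_mat N N" for b c S by (simp add: M_def)
  have mult: "M c d S * M b c R = M b d (\<lambda>x. S (R x))"
    if "ordered_basis N c" "ordered_basis N d" "linear S" for b c d S R
    using that unfolding M_def
    by (intro eq_matI)
      (auto simp: scalar_prod_def lessThan_atLeast0[symmetric]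
        representation_linear_expand[OF that, of "R (b _)"])
  have one: "M b b (\<lambda>x. x) = 1\<^sub>m N" if "ordered_basis N b" for b
    using that unfolding M_def ordered_basis_def
    by (intro eq_matI) (auto simp: real_vector.representation_basis dest: inj_onD)
  have "similar_mat (M f f T) (M e e T)"
  proof (rule similar_matI)
    show "{M f f T, M e e T, M e f (\<lambda>x. x), M f e (\<lambda>x. x)} \<subseteq> carrier_mat N N" using M by auto
    show "M e f (\<lambda>x. x) * M f e (\<lambda>x. x) = 1\<^sub>m N" "M f e (\<lambda>x. x) * M e f (\<lambda>x. x) = 1\<^sub>m N"
      using e f by (auto simp: mult one linear_ident)
    show "M f f T = M e f (\<lambda>x. x) * M e e T * M f e (\<lambda>x. x)"
      using e f T by (simp add: mult linear_ident)
  qed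
  then have "char_poly (M f f T) = char_poly (M e e T)" by (rule char_poly_similar)
  then show ?thesis by (simp add: char_poly_lin_def f_def[symmetric] M_def matrix_in_basis_def)
qed

lemma raise_first_unique:
  fixes \<eta> K :: "'v::real_vector \<Rightarrow> 'v \<Rightarrow> real"
  assumes \<eta>: "lorentz_form N \<eta>" and K: "bilinear K"
  shows "\<exists>!w. \<forall>u. \<eta> u w = K u v"
proof -
  from \<eta> obtain e where e: "ordered_basis N e"
    and d: "\<And>i j. i < N \<Longrightarrow> j < N \<Longrightarrow> \<eta> (e i) (e j) = (if i \<noteq> j then 0 else if i = 0 then - 1 else 1)"
    and B: "bilinear \<eta>" by (auto simp: lorentz_form_def)
  have sp: "span (e ` {..<N}) = UNIV" and inj: "inj_on e {..<N}"
    using e by (auto simp: ordered_basis_def)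
  have lin: "linear (\<lambda>u. \<eta> u w)" "linear (\<lambda>w. \<eta> u w)" "linear (\<lambda>u. K u w)" for u w
    using B K by (auto simp: bilinear_def)
  have ext: "(\<forall>u. \<eta> u w = K u v) \<longleftrightarrow> (\<forall>i<N. \<eta> (e i) w = K (e i) v)" for w
  proof
    assume a: "\<forall>i<N. \<eta> (e i) w = K (e i) v"
    have "(\<lambda>u. \<eta> u w) u = (\<lambda>u. K u v) u" for u
      by (rule linear_eq_on[OF lin(1) lin(3), of u "e ` {..<N}"]) (use sp a in auto)
    then show "\<forall>u. \<eta> u w = K u v" by simp
  qed auto
  define c where "c i = (if i = 0 then - 1 else 1 :: real)" for i :: nat
  have \<eta>sum: "\<eta> (e i) (\<Sum>j<N. a j *\<^sub>R e j) = c i * a i" if "i < N" for i a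
  proof -
    have "\<eta> (e i) (\<Sum>j<N. a j *\<^sub>R e j) = (\<Sum>j<N. a j * \<eta> (e i) (e j))"
      by (simp add: linear_sum[OF lin(2)] linear_scale[OF lin(2)])
    also have "\<dots> = (\<Sum>j<N. if j = i then c i * a i else 0)"
      by (rule sum.cong) (use that in \<open>auto simp: d c_def\<close>)
    finally show ?thesis using that by simp
  qed
  have cc: "c i * c i = 1" for i by (simp add: c_def)
  show ?thesis
  proof (unfold ext, rule ex1I)
    show "\<forall>i<N. \<eta> (e i) (\<Sum>j<N. (c j * K (e j) v) *\<^sub>R e j) = K (e i) v"
      using cc by (simp add: \<eta>sum mult.assoc[symmetric])
  next
    fix w assume w: "\<forall>i<N. \<eta> (e i) w = K (e i) v"
    have "w \<in> range (\<lambda>u. \<Sum>x\<in>e ` {..<N}. u x *\<^sub>R x)"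
      using sp by (simp add: span_finite[symmetric])
    then obtain u where "w = (\<Sum>x\<in>e ` {..<N}. u x *\<^sub>R x)" by auto
    then have u: "w = (\<Sum>j<N. u (e j) *\<^sub>R e j)" by (simp add: sum.reindex[OF inj])
    have "u (e j) = c j * K (e j) v" if "j < N" for j
    proof -
      have "c j * u (e j) = K (e j) v" using w \<eta>sum[OF that, of "\<lambda>j. u (e j)"] that u by simp
      then have "c j * K (e j) v = (c j * c j) * u (e j)" by simp
      then show ?thesis by (simp add: cc)
    qed
    then show "w = (\<Sum>j<N. (c j * K (e j) v) *\<^sub>R e j)" by (subst u, intro sum.cong) auto
  qed
qed

lemma raise_first:
  assumes "lorentz_form N \<eta>" "bilinear K"
  shows "\<eta> u (raise_first \<eta> K v) = K u v"
  using theI'[OF raise_first_unique[OF assms, of v]] by (auto simp: raise_first_def)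

lemma linear_raise_first:
  assumes \<eta>: "lorentz_form N \<eta>" and K: "bilinear K"
  shows "linear (raise_first \<eta> K)"
proof -
  have eq: "raise_first \<eta> K v = w" if "\<And>u. \<eta> u w = K u v" for v w
    using raise_first_unique[OF assms, of v] raise_first[OF assms, of _ v] that by blast
  have B: "bilinear \<eta>" using \<eta> by (simp add: lorentz_form_def)
  show ?thesis
    by (rule linearI; rule eq)
      (simp_all add: bilinear_radd[OF B] bilinear_radd[OF K] bilinear_rmul[OF B]
        bilinear_rmul[OF K] raise_first[OF assms])
qed

end

theory Submission
  imports Defs "HOL-Analysis.Elementary_Metric_Spaces"
begin

text \<open>A null direction \<open>[k]\<close> is aligned iff \<open>k\<close> is an eigenvector of \<open>T = K\<^sup>a\<^sub>b\<close>. Let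
  \<open>p t = det (t - T)\<close>; since \<open>N\<close> is odd, \<open>p 0 = 0\<close> and \<open>\<sigma>\<^bsub>N-1\<^esub> = p' 0\<close>.

  If \<open>T k = \<mu> k\<close> with \<open>k\<close> null, then \<open>p t = (t\<^sup>2 - \<mu>\<^sup>2) D t\<close> where \<open>D t\<close> is the determinant of a matrix
  with positive semidefinite symmetric part, hence \<open>D t \<ge> 0\<close> for \<open>t > 0\<close>, and \<open>p' 0 \<le> 0\<close>.

  Conversely let \<open>p' 0 \<le> 0\<close>. If \<open>p t \<le> 0\<close> for some \<open>t > 0\<close>, then \<open>T\<close> has a positive eigenvalue, and
  its eigenvector is null by skewness. Otherwise, for every \<open>t > 0\<close>, the solution \<open>v = (1, x)\<close> of the
  space-like components of \<open>T v = t v\<close> has \<open>\<bar>x\<bar> < 1\<close>, and a limit point for \<open>t \<rightarrow> 0\<close> is a null or time-like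
  kernel vector of \<open>T\<close>. In the time-like case \<open>p' 0 = 0\<close> yields a space-like kernel vector as well,
  so the kernel contains a null vector.\<close>

section \<open>Determinants of skew pencils\<close>

text \<open>Matrices are given by index functions, so that entries can be rewritten with
  \<open>fdet_cong\<close> under plain index bounds.\<close>

definition fdet :: "nat \<Rightarrow> (nat \<Rightarrow> nat \<Rightarrow> real) \<Rightarrow> real" where
  "fdet n f = det (mat n n (\<lambda>(i, j). f i j))"

lemma fdet_cong:
  assumes "\<And>i j. i < n \<Longrightarrow> j < n \<Longrightarrow> f i j = g i j"
  shows "fdet n f = fdet n g"
  unfolding fdet_def by (rule arg_cong[where f = det]) (use assms in \<open>auto intro!: eq_matI\<close>)

lemma mat_fun_mult_vec:
  "mat n n (\<lambda>(i, j). f i j) *\<^sub>v vec n v = vec n (\<lambda>i. \<Sum>j<n. f i j * v j)"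
  by (intro eq_vecI) (auto simp: scalar_prod_def lessThan_atLeast0)

lemma fdet_eq_0_iff:
  "fdet n f = 0 \<longleftrightarrow> (\<exists>v. (\<exists>i<n. v i \<noteq> 0) \<and> (\<forall>i<n. (\<Sum>j<n. f i j * v j) = 0))"
proof -
  let ?A = "mat n n (\<lambda>(i, j). f i j)"
  have "fdet n f = 0 \<longleftrightarrow> (\<exists>v. v \<in> carrier_vec n \<and> v \<noteq> 0\<^sub>v n \<and> ?A *\<^sub>v v = 0\<^sub>v n)"
    unfolding fdet_def by (rule det_0_iff_vec_prod_zero) simp
  also have "\<dots> \<longleftrightarrow> (\<exists>v. vec n v \<noteq> 0\<^sub>v n \<and> ?A *\<^sub>v vec n v = 0\<^sub>v n)"
    by (metis vec_carrier carrier_vecD eq_vecI dim_vec index_vec)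
  also have "\<dots> \<longleftrightarrow> (\<exists>v. (\<exists>i<n. v i \<noteq> 0) \<and> (\<forall>i<n. (\<Sum>j<n. f i j * v j) = 0))"
    unfolding mat_fun_mult_vec by (intro ex_cong1) (auto simp: vec_eq_iff)
  finally show ?thesis .
qed

text \<open>Cramer's rule. With \<open>v k = 1\<close>, the case of interest below, a column can be
  exchanged for the product with \<open>v\<close> at no cost in the determinant.\<close>

lemma fdet_replace_col:
  assumes "k < n"
  shows "fdet n (\<lambda>i j. if j = k then \<Sum>l<n. f i l * v l else f i j) = v k * fdet n f"
proof -
  let ?A = "mat n n (\<lambda>(i, j). f i j)"
  have "det (replace_col ?A (?A *\<^sub>v vec n v) k) = vec n v $ k * det ?A"
    by (rule cramer_lemma_mat) (use assms in auto)
  moreover have "replace_col ?A (?A *\<^sub>v vec n v) k =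
      mat n n (\<lambda>(i, j). if j = k then \<Sum>l<n. f i l * v l else f i j)"
    unfolding mat_fun_mult_vec by (intro eq_matI) (auto simp: replace_col_def)
  ultimately show ?thesis using assms by (simp add: fdet_def)
qed

lemma fdet_transpose: "fdet n (\<lambda>i j. f j i) = fdet n f"
proof -
  have "mat n n (\<lambda>(i, j). f j i) = transpose_mat (mat n n (\<lambda>(i, j). f i j))"
    by (intro eq_matI) auto
  then show ?thesis by (simp add: fdet_def det_transpose[of _ n])
qed

lemma fdet_replace_row:
  assumes "k < n"
  shows "fdet n (\<lambda>i j. if i = k then \<Sum>l<n. v l * f l j else f i j) = v k * fdet n f"
proof -
  have "fdet n (\<lambda>i j. if i = k then \<Sum>l<n. v l * f l j else f i j) =
      fdet n (\<lambda>i j. if j = k then \<Sum>l<n. f l i * v l else f j i)"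
    by (subst fdet_transpose[symmetric]) (simp only: mult.commute)
  also have "\<dots> = v k * fdet n f"
    by (subst fdet_replace_col[OF assms, of "\<lambda>i j. f j i" v]) (simp only: fdet_transpose[of n f])
  finally show ?thesis .
qed

lemma fdet_scale_row:
  assumes "k < n"
  shows "fdet n (\<lambda>i j. if i = k then a * f i j else f i j) = a * fdet n f"
proof -
  have "fdet n (\<lambda>i j. if i = k then a * f i j else f i j) =
      fdet n (\<lambda>i j. if i = k then \<Sum>l<n. (if l = k then a else 0) * f l j else f i j)"
    using assms by (intro fdet_cong) (simp add: if_distrib[where f = "\<lambda>x. x * _"] cong: if_cong)
  then show ?thesis using fdet_replace_row[OF assms, of "\<lambda>l. if l = k then a else 0" f] by simp
qed

lemma fdet_scale_col:
  assumes "k < n"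
  shows "fdet n (\<lambda>i j. if j = k then a * f i j else f i j) = a * fdet n f"
  by (subst fdet_transpose[symmetric])
    (subst fdet_scale_row[OF assms, of a "\<lambda>i j. f j i"], simp only: fdet_transpose[of n f])

lemma fdet_uminus: "fdet n (\<lambda>i j. - f i j) = (- 1) ^ n * fdet n f"
proof -
  have "mat n n (\<lambda>(i, j). - f i j) = (- 1) \<cdot>\<^sub>m mat n n (\<lambda>(i, j). f i j)"
    by (intro eq_matI) auto
  then show ?thesis by (simp add: fdet_def)
qed

lemma fdet_solve:
  assumes "fdet n f \<noteq> 0"
  obtains w where "\<And>i. i < n \<Longrightarrow> (\<Sum>j<n. f i j * w j) = b i"
proof -
  let ?A = "mat n n (\<lambda>(i, j). f i j)"
  define u where "u = adj_mat ?A *\<^sub>v vec n b"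
  define w where "w i = u $ i / fdet n f" for i
  have A: "?A \<in> carrier_mat n n" by simp
  note adj = adj_mat[OF A]
  have u: "u \<in> carrier_vec n" unfolding u_def using adj(1) by (intro mult_mat_vec_carrier) auto
  have "?A *\<^sub>v u = (?A * adj_mat ?A) *\<^sub>v vec n b"
    unfolding u_def by (rule assoc_mult_mat_vec[symmetric]) (use adj in auto)
  also have "\<dots> = fdet n f \<cdot>\<^sub>v vec n b"
    unfolding adj fdet_def by auto
  finally have *: "?A *\<^sub>v u = fdet n f \<cdot>\<^sub>v vec n b" .
  have "(\<Sum>j<n. f i j * w j) = b i" if "i < n" for i
  proof -
    have "u = vec n (\<lambda>i. u $ i)" using u by auto
    then have "?A *\<^sub>v u = vec n (\<lambda>i. \<Sum>j<n. f i j * u $ j)" by (metis mat_fun_mult_vec)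
    then have "(\<Sum>j<n. f i j * u $ j) = fdet n f * b i"
      using arg_cong[OF *, of "\<lambda>v. v $ i"] that by simp
    then show ?thesis using assms unfolding w_def by (simp add: sum_divide_distrib[symmetric])
  qed
  then show thesis by (rule that)
qed

text \<open>The Leibniz formula makes the determinant a polynomial in the entries.\<close>

lemma continuous_on_fdet:
  assumes "\<And>i j. i < n \<Longrightarrow> j < n \<Longrightarrow> continuous_on S (\<lambda>t. F t i j)"
  shows "continuous_on S (\<lambda>t. fdet n (F t))"
proof -
  have "(\<Prod>i = 0..<n. mat n n (\<lambda>(i, j). F t i j) $$ (i, p i)) = (\<Prod>i = 0..<n. F t i (p i))"
    if "p permutes {0..<n}" for t p
    using permutes_in_image[OF that] by (intro prod.cong) auto
  then have eq: "(\<lambda>t. fdet n (F t)) =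
      (\<lambda>t. \<Sum>p\<in>{p. p permutes {0..<n}}. signof p * (\<Prod>i = 0..<n. F t i (p i)))"
    unfolding fdet_def by (subst det_def'[of _ n]) auto
  show ?thesis
    unfolding eq by (intro continuous_intros assms) (auto dest: permutes_in_image)
qed

lemma poly_char_poly_fdet:
  "poly (char_poly (mat n n (\<lambda>(i, j). f i j))) x = fdet n (\<lambda>i j. (if i = j then x else 0) - f i j)"
  unfolding char_poly_def fdet_def
  by (rule poly_det_cong[of _ n]) (auto simp: char_poly_matrix_def)

lemma char_poly_fdet_monic:
  fixes f :: "nat \<Rightarrow> nat \<Rightarrow> real"
  shows "lead_coeff (char_poly (mat n n (\<lambda>(i, j). f i j))) = 1"
  using degree_monic_char_poly[of "mat n n (\<lambda>(i, j). f i j)" n] by simp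

section \<open>Positivity of determinants\<close>

lemma poly_root_ge:
  fixes p :: "real poly"
  assumes "lead_coeff p > 0" and "poly p a \<le> 0"
  obtains x where "a \<le> x" "poly p x = 0"
proof (cases "poly p a = 0")
  case True
  then show ?thesis using that by blast
next
  case False
  obtain b where "\<And>x. x \<ge> b \<Longrightarrow> poly p x \<ge> lead_coeff p"
    using poly_pinfty_gt_lc[OF assms(1)] by auto
  then have b: "\<And>x. x \<ge> b \<Longrightarrow> poly p x > 0" using assms(1) by (meson less_le_trans)
  have "\<exists>x. a < x \<and> x < max b (a + 1) \<and> poly p x = 0"
    by (rule poly_IVT_pos) (use assms False b[of "max b (a + 1)"] in auto)
  then show ?thesis using that by (meson less_imp_le)
qed

text \<open>Homotopy to the identity: \<open>f + x\<close> stays non-singular for all \<open>x \<ge> 0\<close>.\<close>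
lemma fdet_pos:
  assumes pos: "\<And>v. \<exists>i<n. v i \<noteq> 0 \<Longrightarrow> (\<Sum>i<n. v i * (\<Sum>j<n. f i j * v j)) > 0"
  shows "fdet n f > 0"
proof (rule ccontr)
  \<comment> \<open>\<open>poly ?p x\<close> is the determinant of \<open>f + x\<close>; being
    monic, \<open>?p\<close> has a root \<open>x \<ge> 0\<close> as soon as it is non-positive at
    0.\<close>
  let ?p = "char_poly (mat n n (\<lambda>(i, j). - f i j))"
  assume "\<not> ?thesis"
  then have "poly ?p 0 \<le> 0" by (simp add: poly_char_poly_fdet)
  then obtain x where x: "0 \<le> x" "poly ?p x = 0"
    using poly_root_ge[of ?p 0] char_poly_fdet_monic[of n "\<lambda>i j. - f i j"] by auto
  from x(2) obtain v where v: "\<exists>i<n. v i \<noteq> 0"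
    and 0: "\<And>i. i < n \<Longrightarrow> (\<Sum>j<n. ((if i = j then x else 0) + f i j) * v j) = 0"
    by (auto simp: poly_char_poly_fdet fdet_eq_0_iff)
  have "(\<Sum>j<n. f i j * v j) = - x * v i" if "i < n" for i
    using 0[OF that] that
    by (simp add: distrib_right sum.distrib if_distrib[where f = "\<lambda>x. x * _"] eq_neg_iff_add_eq_0
        add.commute cong: if_cong)
  then have "(\<Sum>i<n. v i * (\<Sum>j<n. f i j * v j)) = (\<Sum>i<n. - x * (v i * v i))"
    by (intro sum.cong refl) (simp add: mult.left_commute)
  also have "\<dots> \<le> 0" using x by (intro sum_nonpos) (auto simp: mult_nonneg_nonneg)
  finally show False using pos[OF v] by simp
qed

text \<open>Exchanging the two summation indices turns the sum into its negative.\<close>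

lemma skew_quadratic_form_0:
  fixes k :: "nat \<Rightarrow> nat \<Rightarrow> real"
  assumes "\<And>i j. i < n \<Longrightarrow> j < n \<Longrightarrow> k i j = - k j i"
  shows "(\<Sum>i<n. v i * (\<Sum>j<n. k i j * v j)) = 0"
proof -
  let ?S = "\<Sum>i<n. \<Sum>j<n. v i * (k i j * v j)"
  have "?S = (\<Sum>j<n. \<Sum>i<n. v i * (k i j * v j))" by (rule sum.swap)
  also have "\<dots> = (\<Sum>j<n. \<Sum>i<n. - (v j * (k j i * v i)))"
    by (intro sum.cong refl, subst assms) auto
  also have "\<dots> = - ?S" by (simp add: sum_negf)
  finally show ?thesis by (simp add: sum_distrib_left)
qed

text \<open>For \<open>k i j = K (e i) (e j)\<close> in an orthonormal basis \<open>e\<close>, \<open>pencil k (- t) t\<close> is the Gram matrix of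
  \<open>t \<eta> - K\<close>, whereas \<open>pencil k s t\<close> with \<open>s, t > 0\<close> has positive definite symmetric part.\<close>
definition pencil :: "(nat \<Rightarrow> nat \<Rightarrow> real) \<Rightarrow> real \<Rightarrow> real \<Rightarrow> nat \<Rightarrow> nat \<Rightarrow> real" where
  "pencil k s t i j = (if i = j then if i = 0 then s else t else 0) - k i j"

lemma pencil_mult:
  assumes "i < n"
  shows "(\<Sum>j<n. pencil k s t i j * v j) = (if i = 0 then s else t) * v i - (\<Sum>j<n. k i j * v j)"
  using assms unfolding pencil_def
  by (simp add: left_diff_distrib sum_subtractf if_distrib[where f = "\<lambda>x. x * _"] cong: if_cong)

text \<open>The skew part drops out of the quadratic form, which leaves the positive
  diagonal.\<close>

lemma fdet_pencil_pos:
  assumes skew: "\<And>i j. i < n \<Longrightarrow> j < n \<Longrightarrow> k i j = - k j i" and "s > 0" "t > 0"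
  shows "fdet n (pencil k s t) > 0"
proof (rule fdet_pos)
  fix v :: "nat \<Rightarrow> real"
  assume "\<exists>i<n. v i \<noteq> 0"
  then obtain i where i: "i < n" "v i \<noteq> 0" by blast
  have "(\<Sum>i<n. v i * (\<Sum>j<n. pencil k s t i j * v j)) =
      (\<Sum>i<n. v i * ((if i = 0 then s else t) * v i) - v i * (\<Sum>j<n. k i j * v j))"
    by (intro sum.cong) (auto simp: pencil_mult right_diff_distrib)
  also have "\<dots> = (\<Sum>i<n. v i * ((if i = 0 then s else t) * v i))"
    using skew_quadratic_form_0[of n k v, OF skew] by (simp add: sum_subtractf)
  also have "\<dots> > 0"
  proof (rule sum_pos2[of _ i])
    have "v i * v i > 0" using i(2) by (simp add: zero_less_mult_iff linorder_neq_iff disj_commute)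
    then show "v i * ((if i = 0 then s else t) * v i) > 0"
      using \<open>s > 0\<close> \<open>t > 0\<close> by (simp add: mult.left_commute[of "v i"])
    show "v j * ((if j = 0 then s else t) * v j) \<ge> 0" for j
      using \<open>s > 0\<close> \<open>t > 0\<close> by (simp add: mult.left_commute[of "v j"])
  qed (use i in auto)
  finally show "(\<Sum>i<n. v i * (\<Sum>j<n. pencil k s t i j * v j)) > 0" .
qed

lemma continuous_on_at_right_0:
  fixes f :: "real \<Rightarrow> real"
  assumes "continuous_on UNIV f"
  shows "(f \<longlongrightarrow> f 0) (at_right 0)"
  using assms by (simp add: continuous_on_eq_continuous_at isCont_def filterlim_at_split)

text \<open>Limit \<open>s \<rightarrow> 0\<close> from the right in \<open>fdet_pencil_pos\<close>.
  The boundary value \<open>s = 0\<close> is what splitting off a null eigenvector leaves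
  behind.\<close>

lemma fdet_pencil_nonneg:
  assumes skew: "\<And>i j. i < n \<Longrightarrow> j < n \<Longrightarrow> k i j = - k j i" and "t > 0"
  shows "fdet n (pencil k 0 t) \<ge> 0"
proof -
  have "continuous_on UNIV (\<lambda>s. fdet n (pencil k s t))"
  proof (rule continuous_on_fdet)
    show "continuous_on UNIV (\<lambda>s. pencil k s t i j)" for i j
      unfolding pencil_def by (cases "i = j"; cases "i = 0") (auto intro!: continuous_intros)
  qed
  then have "((\<lambda>s. fdet n (pencil k s t)) \<longlongrightarrow> fdet n (pencil k 0 t)) (at_right 0)"
    by (rule continuous_on_at_right_0)
  moreover have "eventually (\<lambda>s. fdet n (pencil k s t) \<ge> 0) (at_right 0)"
    unfolding eventually_at_right_field
    by (intro exI[of _ 1]) (use fdet_pencil_pos[of n k, OF skew] \<open>t > 0\<close> in \<open>auto intro: less_imp_le\<close>)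
  ultimately show ?thesis by (rule tendsto_lowerbound) simp
qed

section \<open>Null eigenvectors in coordinates\<close>

lemma sum_lessThan_split_0:
  fixes f :: "nat \<Rightarrow> real"
  assumes "0 < n"
  shows "(\<Sum>i<n. f i) = f 0 + (\<Sum>i=1..<n. f i)"
  using assms by (simp add: lessThan_atLeast0 sum.atLeast_Suc_lessThan)

lemma sum_squares_from_1_eq_0:
  fixes v :: "nat \<Rightarrow> real"
  assumes "v 0 = 0" and "(\<Sum>i=1..<n. (v i)\<^sup>2) = 0" and "i < n"
  shows "v i = 0"
proof (cases "i = 0")
  case False
  have "\<forall>i\<in>{1..<n}. (v i)\<^sup>2 = 0"
    using assms(2) by (subst (asm) sum_nonneg_eq_0_iff) auto
  then show ?thesis using False assms(3) by simp
qed (use assms in simp)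

text \<open>The diagonal of \<eta> in an orthonormal basis with the time-like vector at index 0. It
  is its own inverse, so it lowers and raises indices alike.\<close>

definition msign :: "nat \<Rightarrow> real" where
  "msign i = (if i = 0 then - 1 else 1)"

lemma pencil_minkowski_mult:
  assumes "i < n"
  shows "(\<Sum>j<n. pencil k (- t) t i j * v j) = t * (msign i * v i) - (\<Sum>j<n. k i j * v j)"
  using pencil_mult[OF assms, of k "- t" t v] by (simp add: msign_def)

text \<open>Replacing column 0 by the combination with coefficients \<open>v\<close>, and then row 0 likewise, splits off
  the factors \<open>t - m\<close> and \<open>t + m\<close>; what remains is again a skew pencil, with \<open>s = 0\<close>.\<close>
lemma fdet_pencil_null_eigenvector:
  assumes skew: "\<And>i j. i < n \<Longrightarrow> j < n \<Longrightarrow> k i j = - k j i" and "0 < n"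
    and v0: "v 0 = 1" and null: "(\<Sum>i=1..<n. (v i)\<^sup>2) = 1"
    and eig: "\<And>i. i < n \<Longrightarrow> (\<Sum>j<n. k i j * v j) = m * (msign i * v i)"
  obtains D where "\<And>t. t > 0 \<Longrightarrow> D t \<ge> 0" "continuous_on UNIV D"
    "\<And>t. fdet n (pencil k (- t) t) = - ((t\<^sup>2 - m\<^sup>2) * D t)"
proof -
  \<comment> \<open>Entries of the remainder: nullity of \<open>v\<close> makes the corner entry
    vanish, and the minus sign in the factor \<open>- (t + m)\<close> taken out of row 0 makes
    \<open>k'\<close> skew.\<close>
  define k' where "k' i j = (if i = 0 then if j = 0 then 0 else v j else if j = 0 then - v i else k i j)"
    for i j
  define D where "D t = fdet n (pencil k' 0 t)" for t
  have skew': "k' i j = - k' j i" if "i < n" "j < n" for i j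
    using skew[OF that] by (simp add: k'_def)
  have null': "(\<Sum>l<n. v l * (msign l * v l)) = 0"
    using null v0 \<open>0 < n\<close> by (simp add: sum_lessThan_split_0 msign_def power2_eq_square)
  \<comment> \<open>By skewness \<open>v\<close> is, up to \<open>msign\<close>, also a left
    eigenvector; the sign change turns the factor \<open>t - m\<close> of the column into
    \<open>t + m\<close> for the row.\<close>
  have kv: "(\<Sum>l<n. v l * k l j) = - (m * (msign j * v j))" if "j < n" for j
  proof -
    have "(\<Sum>l<n. v l * k l j) = (\<Sum>l<n. - (k j l * v l))"
      by (intro sum.cong refl, subst skew) (use that in auto)
    then show ?thesis using eig[OF that] by (simp add: sum_negf)
  qed
  have det: "fdet n (pencil k (- t) t) = - ((t\<^sup>2 - m\<^sup>2) * D t)" for t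
  proof -
    define F where "F = pencil k (- t) t"
    define Q where "Q i j = (if j = 0 then msign i * v i else F i j)" for i j
    have Fv: "(\<Sum>j<n. F i j * v j) = (t - m) * (msign i * v i)" if "i < n" for i
      using eig[OF that] by (simp add: F_def pencil_minkowski_mult[OF that] left_diff_distrib)
    have vF: "(\<Sum>l<n. v l * F l j) = (t + m) * v j" if "j < n" "j \<noteq> 0" for j
    proof -
      have "(\<Sum>l<n. v l * F l j) = (\<Sum>l<n. (if l = j then t * v l else 0) - v l * k l j)"
        using that(2) by (intro sum.cong) (auto simp: F_def pencil_def right_diff_distrib)
      also have "\<dots> = (t + m) * v j"
        using that by (simp add: sum_subtractf kv msign_def distrib_right)
      finally show ?thesis .
    qed
    have "fdet n F = fdet n (\<lambda>i j. if j = 0 then \<Sum>l<n. F i l * v l else F i j)"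
      using fdet_replace_col[OF \<open>0 < n\<close>, of F v] v0 by simp
    also have "\<dots> = fdet n (\<lambda>i j. if j = 0 then (t - m) * Q i j else Q i j)"
      by (intro fdet_cong) (auto simp: Fv Q_def)
    also have "\<dots> = (t - m) * fdet n Q" by (rule fdet_scale_col) fact
    also have "fdet n Q = fdet n (\<lambda>i j. if i = 0 then \<Sum>l<n. v l * Q l j else Q i j)"
      using fdet_replace_row[OF \<open>0 < n\<close>, of v Q] v0 by simp
    also have "\<dots> = fdet n (\<lambda>i j. if i = 0 then - (t + m) * pencil k' 0 t i j else pencil k' 0 t i j)"
    proof (rule fdet_cong)
      fix i j assume "i < n" "j < n"
      then show "(if i = 0 then \<Sum>l<n. v l * Q l j else Q i j) =
          (if i = 0 then - (t + m) * pencil k' 0 t i j else pencil k' 0 t i j)"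
      proof (cases "i = 0")
        case True
        have "(\<Sum>l<n. v l * Q l j) = - (t + m) * pencil k' 0 t 0 j"
        proof (cases "j = 0")
          case False
          then have "(\<Sum>l<n. v l * Q l j) = (\<Sum>l<n. v l * F l j)" by (simp add: Q_def)
          then show ?thesis using vF[OF \<open>j < n\<close> False] False
            by (simp add: k'_def pencil_def algebra_simps)
        qed (simp add: Q_def null' k'_def pencil_def)
        then show ?thesis using True by simp
      qed (auto simp: Q_def k'_def pencil_def F_def msign_def)
    qed
    also have "\<dots> = - (t + m) * D t"
      unfolding D_def by (rule fdet_scale_row) fact
    finally show ?thesis by (simp add: F_def power2_eq_square algebra_simps)
  qed
  moreover have "D t \<ge> 0" if "t > 0" for t
    unfolding D_def by (rule fdet_pencil_nonneg[OF skew' that])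
  moreover have "continuous_on UNIV D"
    unfolding D_def
  proof (rule continuous_on_fdet)
    show "continuous_on UNIV (\<lambda>t. pencil k' 0 t i j)" for i j
      unfolding pencil_def by (cases "i = j"; cases "i = 0") (auto intro!: continuous_intros)
  qed
  ultimately show ?thesis using that by blast
qed

section \<open>From a null eigenvector to the sign of the linear coefficient\<close>

lemma continuous_limit_le_0:
  fixes f :: "real \<Rightarrow> real"
  assumes "continuous_on UNIV f" and "b > 0" and "\<And>t. 0 < t \<Longrightarrow> t < b \<Longrightarrow> f t \<le> 0"
  shows "f 0 \<le> 0"
proof (rule tendsto_upperbound[OF continuous_on_at_right_0[OF assms(1)]])
  show "eventually (\<lambda>t. f t \<le> 0) (at_right 0)"
    unfolding eventually_at_right_field using assms(2,3) by blast
qed simp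

text \<open>Dividing \<open>p\<close> by \<open>t\<close> gives \<open>q\<close> with
  \<open>poly q 0 = coeff p 1\<close> and
  \<open>t * poly q t = (t\<^sup>2 - m\<^sup>2) * D t\<close>, which is non-positive for
  \<open>0 < t < \<bar>m\<bar>\<close>; let \<open>t\<close> tend to 0.\<close>

lemma sigma_le_0_if_null_eigenvector:
  fixes p :: "real poly"
  assumes skew: "\<And>i j. i < n \<Longrightarrow> j < n \<Longrightarrow> k i j = - k j i" and "0 < n"
    and p: "\<And>t. poly p t = - fdet n (pencil k (- t) t)" and p0: "coeff p 0 = 0"
    and v: "v 0 = 1" "(\<Sum>i=1..<n. (v i)\<^sup>2) = 1"
      "\<And>i. i < n \<Longrightarrow> (\<Sum>j<n. k i j * v j) = m * (msign i * v i)"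
  shows "coeff p 1 \<le> 0"
proof -
  obtain D where D: "\<And>t. t > 0 \<Longrightarrow> D t \<ge> 0" "continuous_on UNIV D"
    and det: "\<And>t. fdet n (pencil k (- t) t) = - ((t\<^sup>2 - m\<^sup>2) * D t)"
    using fdet_pencil_null_eigenvector[of n k v m, OF skew \<open>0 < n\<close> v] by blast
  obtain q where q: "p = pCons 0 q" using p0 by (metis coeff_pCons_0 pCons_cases)
  have qD: "t * poly q t = (t\<^sup>2 - m\<^sup>2) * D t" for t using p[of t] by (simp add: q det)
  have cq: "continuous_on UNIV (poly q)" by (intro continuous_intros)
  have "poly q 0 \<le> 0"
  proof (cases "m = 0")
    case False
    show ?thesis
    proof (rule continuous_limit_le_0[OF cq])
      show "\<bar>m\<bar> > 0" using False by simp
      fix t assume t: "0 < t" "t < \<bar>m\<bar>"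
      then have "t\<^sup>2 \<le> m\<^sup>2" by (simp add: abs_le_square_iff[symmetric])
      then have "t * poly q t \<le> 0" unfolding qD using D(1)[OF t(1)] by (simp add: mult_nonpos_nonneg)
      then show "poly q t \<le> 0" using t by (simp add: mult_le_0_iff)
    qed
  next
    case True
    \<comment> \<open>For \<open>m = 0\<close> the interval is empty; cancelling \<open>t\<close>
      instead leaves \<open>poly q t = t * D t\<close>, which tends to 0.\<close>
    have "poly q t - t * D t = 0" if "0 < t" for t
      using qD[of t] that True by (simp add: power2_eq_square)
    moreover have "continuous_on UNIV (\<lambda>t. poly q t - t * D t)"
      by (intro continuous_intros cq D(2))
    ultimately show ?thesis
      using continuous_limit_le_0[of "\<lambda>t. poly q t - t * D t" 1] by simp
  qed
  then show ?thesis by (simp add: q poly_0_coeff_0)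
qed

section \<open>From the sign of the linear coefficient to a null eigenvector\<close>

lemma bounded_coordinates_subsequence:
  fixes V :: "nat \<Rightarrow> nat \<Rightarrow> real"
  assumes "\<And>l i. i < n \<Longrightarrow> \<bar>V l i\<bar> \<le> b"
  obtains r y where "strict_mono r" "\<And>i. i < n \<Longrightarrow> (\<lambda>l. V (r l) i) \<longlonglongrightarrow> y i"
  using assms
\<comment> \<open>Bolzano-Weierstrass one coordinate at a time, each step thinning the previous
  subsequence further.\<close>
proof (induction n arbitrary: thesis)
  case 0
  then show ?case using strict_mono_id by blast
next
  case (Suc n)
  obtain r y where r: "strict_mono r" "\<And>i. i < n \<Longrightarrow> (\<lambda>l. V (r l) i) \<longlonglongrightarrow> y i"
    using Suc.IH Suc.prems(2) by (metis less_Suc_eq)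
  have "bounded (range (\<lambda>l. V (r l) n))"
    using Suc.prems(2)[of n] by (auto simp: bounded_iff)
  then obtain a s where s: "strict_mono s" "((\<lambda>l. V (r l) n) \<circ> s) \<longlonglongrightarrow> a"
    using bounded_imp_convergent_subsequence by blast
  show ?case
  proof (rule Suc.prems(1))
    show "strict_mono (r \<circ> s)" using r(1) s(1) by (rule strict_mono_o)
    show "(\<lambda>l. V ((r \<circ> s) l) i) \<longlonglongrightarrow> (if i < n then y i else a)" if "i < Suc n" for i
    proof (cases "i < n")
      case True
      then show ?thesis using LIMSEQ_subseq_LIMSEQ[OF r(2) s(1), of i] by (simp add: o_def)
    next
      case False
      then have "i = n" using that by simp
      then show ?thesis using s(2) by (simp add: o_def)
    qed
  qed
qed

text \<open>The space-like rows do not involve \<open>s\<close>, so they can be solved with the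
  definite pencil \<open>s = 1\<close>. The determinant is affine in \<open>s\<close>, and its signs
  at \<open>s = 1\<close> and \<open>s = - t\<close> bound the space-like part of the
  solution.\<close>

lemma pencil_timelike_solution:
  assumes skew: "\<And>i j. i < n \<Longrightarrow> j < n \<Longrightarrow> k i j = - k j i" and "0 < n" and "t > 0"
    and neg: "fdet n (pencil k (- t) t) < 0"
  obtains v where "v 0 = 1" "\<And>i. 0 < i \<Longrightarrow> i < n \<Longrightarrow> (\<Sum>j<n. k i j * v j) = t * v i"
    "(\<Sum>i=1..<n. (v i)\<^sup>2) < 1"
proof -
  have pos: "fdet n (pencil k 1 t) > 0"
    by (rule fdet_pencil_pos[OF skew]) (use \<open>t > 0\<close> in auto)
  obtain w where w: "\<And>i. i < n \<Longrightarrow> (\<Sum>j<n. pencil k 1 t i j * w j) = (if i = 0 then 1 else 0)"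
    using fdet_solve[of n "pencil k 1 t" "\<lambda>i. if i = 0 then 1 else 0"] pos by auto
  have kw: "(\<Sum>j<n. k i j * w j) = t * w i" if "0 < i" "i < n" for i
    using w[OF that(2)] that by (simp add: pencil_mult)
  have kw0: "(\<Sum>j<n. k 0 j * w j) = w 0 - 1"
    using w[OF \<open>0 < n\<close>] pencil_mult[OF \<open>0 < n\<close>, of k 1 t w] by simp
  \<comment> \<open>Pairing \<open>k w\<close> with \<open>w\<close> gives 0 by skewness; row 0 of
    \<open>k w\<close> is \<open>w 0 - 1\<close>, every other row is \<open>t * w i\<close>.\<close>
  have skw: "w 0 * (w 0 - 1) + t * (\<Sum>i=1..<n. (w i)\<^sup>2) = 0"
  proof -
    have "0 = (\<Sum>i<n. w i * (\<Sum>j<n. k i j * w j))" using skew_quadratic_form_0[of n k w, OF skew] by simp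
    also have "\<dots> = w 0 * (w 0 - 1) + (\<Sum>i=1..<n. w i * (\<Sum>j<n. k i j * w j))"
      using sum_lessThan_split_0[OF \<open>0 < n\<close>] kw0 by simp
    also have "(\<Sum>i=1..<n. w i * (\<Sum>j<n. k i j * w j)) = (\<Sum>i=1..<n. t * (w i)\<^sup>2)"
      by (intro sum.cong) (auto simp: kw power2_eq_square)
    finally show ?thesis by (simp add: sum_distrib_left)
  qed
  \<comment> \<open>Otherwise \<open>skw\<close> forces \<open>w = 0\<close>, against the right-hand
    side 1 in row 0.\<close>
  have "w 0 \<noteq> 0"
  proof
    assume 0: "w 0 = 0"
    then have "(\<Sum>i=1..<n. (w i)\<^sup>2) = 0" using skw \<open>t > 0\<close> by simp
    with 0 have "w i = 0" if "i < n" for i using sum_squares_from_1_eq_0 that by blast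
    then have "(\<Sum>j<n. k 0 j * w j) = 0" by simp
    with kw0 0 show False by simp
  qed
  define v where "v i = w i / w 0" for i
  define S where "S = (\<Sum>i=1..<n. (v i)\<^sup>2)"
  have v0: "v 0 = 1" using \<open>w 0 \<noteq> 0\<close> by (simp add: v_def)
  have kvw: "(\<Sum>j<n. k i j * v j) = (\<Sum>j<n. k i j * w j) / w 0" for i
    by (simp add: v_def sum_divide_distrib)
  have kv: "(\<Sum>j<n. k i j * v j) = t * v i" if "0 < i" "i < n" for i
    unfolding kvw kw[OF that] by (simp add: v_def)
  have "(\<Sum>i=1..<n. (w i)\<^sup>2) = (w 0)\<^sup>2 * S"
    unfolding S_def v_def using \<open>w 0 \<noteq> 0\<close> by (simp add: power_divide flip: sum_divide_distrib)
  with skw have "w 0 * (w 0 - 1 + t * S * w 0) = 0"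
    by (simp add: algebra_simps power2_eq_square)
  then have "w 0 - 1 = - t * S * w 0" using \<open>w 0 \<noteq> 0\<close> by (simp only: mult_eq_0_iff) simp
  then have kv0: "(\<Sum>j<n. k 0 j * v j) = - t * S"
    using \<open>w 0 \<noteq> 0\<close> unfolding kvw kw0 by simp
  \<comment> \<open>\<open>s\<close> occurs only in column 0, so \<open>b\<close> does not depend on it; compare \<open>s = 1\<close> with \<open>s = - t\<close>.\<close>
  define b where "b = fdet n (\<lambda>i j. if j = 0 then if i = 0 then 1 else 0 else pencil k 0 t i j)"
  have b: "fdet n (pencil k s t) = (s + t * S) * b" for s
  proof -
    have "fdet n (pencil k s t) =
        fdet n (\<lambda>i j. if j = 0 then \<Sum>l<n. pencil k s t i l * v l else pencil k s t i j)"
      using fdet_replace_col[OF \<open>0 < n\<close>, of "pencil k s t" v] v0 by simp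
    \<comment> \<open>\<open>v\<close> solves the space-like rows, so only the entry
      \<open>s + t * S\<close> in row 0 survives in the new column.\<close>
    also have "\<dots> = fdet n (\<lambda>i j. if j = 0 then (s + t * S) * (if j = 0 then if i = 0 then 1 else 0 else pencil k 0 t i j)
        else (if j = 0 then if i = 0 then 1 else 0 else pencil k 0 t i j))"
      by (intro fdet_cong) (auto simp: pencil_mult kv kv0 v0, auto simp: pencil_def)
    also have "\<dots> = (s + t * S) * b"
      unfolding b_def by (rule fdet_scale_col) fact
    finally show ?thesis .
  qed
  have "S \<ge> 0" unfolding S_def by (intro sum_nonneg) auto
  then have "1 + t * S > 0" using \<open>t > 0\<close> by (simp add: add_pos_nonneg)
  then have "b > 0" using pos b[of 1] by (simp add: zero_less_mult_iff)
  then have "- t + t * S < 0" using neg b[of "- t"] by (simp add: mult_less_0_iff)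
  then have "t * S < t * 1" by simp
  then have "S < 1" using \<open>t > 0\<close> by (simp only: mult_less_cancel_left_pos)
  then show thesis using that[of v] v0 kv unfolding S_def by blast
qed

text \<open>A null vector without time component has a space-like part of length 0, hence vanishes;
  so a non-zero null vector can be rescaled to time component 1.\<close>

lemma minkowski_null_normalize:
  fixes v :: "nat \<Rightarrow> real"
  assumes "0 < n" and "\<exists>i<n. v i \<noteq> 0" and null: "(\<Sum>i<n. v i * (msign i * v i)) = 0"
  shows "v 0 \<noteq> 0" and "(\<Sum>i=1..<n. (v i / v 0)\<^sup>2) = 1"
proof -
  have eq: "(\<Sum>i=1..<n. (v i)\<^sup>2) = (v 0)\<^sup>2"
    using null by (simp add: sum_lessThan_split_0[OF assms(1)] msign_def power2_eq_square)
  show "v 0 \<noteq> 0"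
  proof
    assume 0: "v 0 = 0"
    then have "(\<Sum>i=1..<n. (v i)\<^sup>2) = 0" using eq by simp
    with 0 show False using assms(2) sum_squares_from_1_eq_0 by blast
  qed
  then show "(\<Sum>i=1..<n. (v i / v 0)\<^sup>2) = 1"
    using eq by (simp add: power_divide sum_divide_distrib[symmetric])
qed

text \<open>The eigenvalue obtained is positive if \<open>p\<close> takes a non-positive value on
  the positive axis, and 0 otherwise.\<close>

lemma null_eigenvector_if_sigma_le_0:
  fixes p :: "real poly"
  assumes skew: "\<And>i j. i < n \<Longrightarrow> j < n \<Longrightarrow> k i j = - k j i" and "0 < n"
    and p: "\<And>t. poly p t = - fdet n (pencil k (- t) t)" and p0: "coeff p 0 = 0"
    and monic: "lead_coeff p = 1" and p1: "coeff p 1 \<le> 0"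
  obtains v m where "v 0 = 1" "(\<Sum>i=1..<n. (v i)\<^sup>2) = 1"
      "\<And>i. i < n \<Longrightarrow> (\<Sum>j<n. k i j * v j) = m * (msign i * v i)"
proof (cases "\<exists>t>0. poly p t \<le> 0")
  case True
  then obtain t where t: "t > 0" "poly p t \<le> 0" by blast
  have "lead_coeff p > 0" using monic by simp
  from poly_root_ge[OF this t(2)] obtain m where "t \<le> m" "poly p m = 0" .
  then have m: "m > 0" "poly p m = 0" using t(1) by simp_all
  then have "fdet n (pencil k (- m) m) = 0" using p[of m] by simp
  then obtain v where v: "\<exists>i<n. v i \<noteq> 0"
    and "\<And>i. i < n \<Longrightarrow> (\<Sum>j<n. pencil k (- m) m i j * v j) = 0"
    unfolding fdet_eq_0_iff by blast
  then have eig: "(\<Sum>j<n. k i j * v j) = m * (msign i * v i)" if "i < n" for i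
    using that by (simp add: pencil_minkowski_mult)
  \<comment> \<open>Pairing the eigenvector equation with \<open>v\<close> shows that
    \<open>m\<close> times the norm of \<open>v\<close> is 0, and \<open>m > 0\<close>.\<close>
  have "(\<Sum>i<n. v i * (m * (msign i * v i))) = (\<Sum>i<n. v i * (\<Sum>j<n. k i j * v j))"
    by (intro sum.cong) (auto simp: eig)
  also have "\<dots> = 0" using skew_quadratic_form_0[of n k v, OF skew] .
  finally have "m * (\<Sum>i<n. v i * (msign i * v i)) = 0"
    by (simp add: sum_distrib_left mult.left_commute)
  then have "(\<Sum>i<n. v i * (msign i * v i)) = 0" using m(1) by simp
  note norm = minkowski_null_normalize[OF \<open>0 < n\<close> v this]
  show thesis
  proof (rule that[of "\<lambda>i. v i / v 0" m])
    show "(\<Sum>j<n. k i j * (v j / v 0)) = m * (msign i * (v i / v 0))" if "i < n" for i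
      using eig[OF that] by (simp add: sum_divide_distrib[symmetric])
  qed (use norm in auto)
next
  case False
  then have pos: "poly p t > 0" if "t > 0" for t using that by (meson not_le)
  \<comment> \<open>The parameter \<open>t = 1 / (l + 1)\<close> tends to 0; \<open>p t > 0\<close>
    supplies the negative determinant.\<close>
  have "\<exists>v. v 0 = 1 \<and> (\<forall>i. 0 < i \<longrightarrow> i < n \<longrightarrow> (\<Sum>j<n. k i j * v j) = inverse (Suc l) * v i) \<and>
      (\<Sum>i=1..<n. (v i)\<^sup>2) < 1" for l
  proof (rule pencil_timelike_solution[of n k "inverse (Suc l)", OF skew \<open>0 < n\<close>])
    show "fdet n (pencil k (- inverse (real (Suc l))) (inverse (real (Suc l)))) < 0"
      using pos[of "inverse (Suc l)"] unfolding p by simp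
  qed auto
  then obtain V where V: "\<And>l. V l 0 = 1"
    "\<And>l i. 0 < i \<Longrightarrow> i < n \<Longrightarrow> (\<Sum>j<n. k i j * V l j) = inverse (Suc l) * V l i"
    "\<And>l. (\<Sum>i=1..<n. (V l i)\<^sup>2) < 1"
    by metis
  have bound: "\<bar>V l i\<bar> \<le> 1" if "i < n" for l i
  proof (cases "i = 0")
    case False
    then have "(V l i)\<^sup>2 \<le> (\<Sum>i=1..<n. (V l i)\<^sup>2)"
      by (intro member_le_sum) (use that in auto)
    also have "\<dots> \<le> 1" using V(3) by (simp add: less_imp_le)
    finally show ?thesis by (simp add: abs_square_le_1)
  qed (simp add: V)
  obtain r y where r: "strict_mono r" and lim: "\<And>i. i < n \<Longrightarrow> (\<lambda>l. V (r l) i) \<longlonglongrightarrow> y i"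
    using bounded_coordinates_subsequence[of n V 1] bound by blast
  have y0: "y 0 = 1" using lim[OF \<open>0 < n\<close>] by (simp add: V LIMSEQ_const_iff)
  have "(\<lambda>l. \<Sum>i=1..<n. (V (r l) i)\<^sup>2) \<longlonglongrightarrow> (\<Sum>i=1..<n. (y i)\<^sup>2)"
    by (intro tendsto_intros lim) auto
  then have S: "(\<Sum>i=1..<n. (y i)\<^sup>2) \<le> 1"
    by (rule LIMSEQ_le_const2) (use V(3) less_imp_le in blast)
  have ky: "(\<Sum>j<n. k i j * y j) = 0" if "0 < i" "i < n" for i
  proof (rule LIMSEQ_unique)
    show "(\<lambda>l. \<Sum>j<n. k i j * V (r l) j) \<longlonglongrightarrow> (\<Sum>j<n. k i j * y j)"
      by (intro tendsto_intros lim) auto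
    have "(\<lambda>l. inverse (real (Suc (r l)))) \<longlonglongrightarrow> 0"
      using LIMSEQ_subseq_LIMSEQ[OF LIMSEQ_inverse_real_of_nat r] by (simp add: o_def)
    then show "(\<lambda>l. \<Sum>j<n. k i j * V (r l) j) \<longlonglongrightarrow> 0"
      unfolding V(2)[OF that] using lim[OF that(2)] tendsto_mult by fastforce
  qed
  \<comment> \<open>Row 0 is absent from the limit equations. The other rows vanish and
    \<open>y 0 = 1\<close>, so row 0 equals the full quadratic form, which is 0 by skewness.\<close>
  have "(\<Sum>i<n. y i * (\<Sum>j<n. k i j * y j)) = (\<Sum>j<n. k 0 j * y j)"
    using y0 ky by (simp add: sum_lessThan_split_0[OF \<open>0 < n\<close>, of "\<lambda>i. y i * _ i"])
  then have ky: "(\<Sum>j<n. k i j * y j) = 0" if "i < n" for i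
    using ky skew_quadratic_form_0[of n k y, OF skew] that by (cases "i = 0") auto
  show thesis
  proof (cases "(\<Sum>i=1..<n. (y i)\<^sup>2) = 1")
    case True
    then show thesis using that[of y 0] y0 ky by simp
  next
    case False
    \<comment> \<open>\<open>y\<close> is a time-like kernel vector; a vanishing \<open>\<sigma>\<close> forces a second, space-like one, and some
      combination of the two is null.\<close>
    define Q where "Q t i j = (if j = 0 then msign i * y i else pencil k (- t) t i j)" for t i j
    have detQ: "fdet n (pencil k (- t) t) = t * fdet n (Q t)" for t
    proof -
      have "fdet n (pencil k (- t) t) =
          fdet n (\<lambda>i j. if j = 0 then \<Sum>l<n. pencil k (- t) t i l * y l else pencil k (- t) t i j)"
        using fdet_replace_col[OF \<open>0 < n\<close>, of "pencil k (- t) t" y] y0 by simp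
      also have "\<dots> = fdet n (\<lambda>i j. if j = 0 then t * Q t i j else Q t i j)"
        by (intro fdet_cong) (auto simp: Q_def pencil_minkowski_mult ky)
      also have "\<dots> = t * fdet n (Q t)" by (rule fdet_scale_col) fact
      finally show ?thesis .
    qed
    have contQ: "continuous_on UNIV (\<lambda>t. fdet n (Q t))"
    proof (rule continuous_on_fdet)
      show "continuous_on UNIV (\<lambda>t. Q t i j)" for i j
        unfolding Q_def pencil_def
        by (cases "j = 0"; cases "i = j"; cases "i = 0") (auto intro!: continuous_intros)
    qed
    obtain q where q: "p = pCons 0 q" using p0 by (metis coeff_pCons_0 pCons_cases)
    have qQ: "poly q t = - fdet n (Q t)" if "t > 0" for t
      using p[of t] that by (simp add: q detQ flip: mult_minus_right)
    have cq: "continuous_on UNIV (poly q)" by (intro continuous_intros)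
    have "poly q 0 \<le> 0" using p1 by (simp add: q poly_0_coeff_0)
    moreover have "fdet n (Q 0) \<le> 0"
    proof (rule continuous_limit_le_0[OF contQ, of 1])
      fix t :: real assume "0 < t"
      then show "fdet n (Q t) \<le> 0" using pos[of t] qQ[of t]
          by (simp add: q zero_less_mult_iff mult_less_0_iff)
    qed simp
    \<comment> \<open>The sum \<open>poly q t + fdet n (Q t)\<close> is 0 for \<open>t > 0\<close>,
      hence non-negative at 0; both summands there are non-positive, so both vanish.\<close>
    moreover have "- (poly q 0 + fdet n (Q 0)) \<le> 0"
      by (rule continuous_limit_le_0[where b = 1 and f = "\<lambda>t. - (poly q t + fdet n (Q t))"])
        (use cq contQ qQ in \<open>auto intro!: continuous_intros\<close>)
    ultimately have "fdet n (Q 0) = 0" by linarith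
    then obtain u where u: "\<exists>i<n. u i \<noteq> 0" and Qu: "\<And>i. i < n \<Longrightarrow> (\<Sum>j<n. Q 0 i j * u j) = 0"
      unfolding fdet_eq_0_iff by blast
    \<comment> \<open>\<open>u 0\<close> is the coefficient of the exchanged column, not a time
      component; \<open>u'\<close> collects the remaining coefficients.\<close>
    define u' where "u' i = (if i = 0 then 0 else u i)" for i
    have Qu': "u 0 * (msign i * y i) = (\<Sum>j<n. k i j * u' j)" if "i < n" for i
      using Qu[OF that] unfolding sum_lessThan_split_0[OF \<open>0 < n\<close>]
      by (simp add: Q_def u'_def pencil_def sum_negf mult.commute[of "u 0"] cong: if_cong)
    \<comment> \<open>Pairing \<open>k u'\<close> with the kernel vector \<open>y\<close> gives 0 by
      skewness, so \<open>u 0\<close> times the norm of \<open>y\<close> is 0. As \<open>y\<close>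
      is time-like, \<open>u 0 = 0\<close>, and \<open>u\<close> itself is a kernel vector with
      vanishing time component.\<close>
    have "(\<Sum>i<n. y i * (\<Sum>j<n. k i j * u' j)) = (\<Sum>j<n. u' j * (\<Sum>i<n. y i * k i j))"
      unfolding sum_distrib_left by (subst sum.swap) (simp add: mult_ac)
    also have "\<dots> = (\<Sum>j<n. u' j * - (\<Sum>i<n. k j i * y i))"
      unfolding sum_negf[symmetric]
      by (intro sum.cong refl arg_cong2[where f = "(*)"], subst skew) auto
    also have "\<dots> = 0" by (simp add: ky)
    finally have "(\<Sum>i<n. y i * (u 0 * (msign i * y i))) = 0"
      by (simp add: Qu')
    then have "u 0 * (\<Sum>i<n. y i * (msign i * y i)) = 0"
      by (simp add: sum_distrib_left mult.left_commute)
    moreover have "(\<Sum>i<n. y i * (msign i * y i)) = (\<Sum>i=1..<n. (y i)\<^sup>2) - 1"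
      using y0 by (simp add: sum_lessThan_split_0[OF \<open>0 < n\<close>] msign_def power2_eq_square)
    ultimately have u0: "u 0 = 0" using False by simp
    then have "u' = u" by (auto simp: u'_def)
    with Qu' u0 have ku: "(\<Sum>j<n. k i j * u j) = 0" if "i < n" for i using that by simp
    obtain i where i: "i < n" "u i \<noteq> 0" using u by blast
    then have "i \<noteq> 0" using u0 by metis
    then have uu: "(\<Sum>i=1..<n. (u i)\<^sup>2) > 0"
      by (intro sum_pos2[of _ i]) (use i in auto)
    \<comment> \<open>The norm of \<open>y + c u\<close> as a quadratic polynomial in
      \<open>c\<close>: non-positive at 0, with positive leading coefficient.\<close>
    let ?f = "[:(\<Sum>i=1..<n. (y i)\<^sup>2) - 1, 2 * (\<Sum>i=1..<n. y i * u i), \<Sum>i=1..<n. (u i)\<^sup>2:]"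
    have "poly ?f 0 \<le> 0" "lead_coeff ?f > 0" using S uu by simp_all
    then obtain c where c: "poly ?f c = 0" using poly_root_ge by blast
    have "(\<Sum>i=1..<n. (y i + c * u i)\<^sup>2) = (\<Sum>i=1..<n. (y i)\<^sup>2 + c * (2 * (y i * u i)) + c * (c * (u i)\<^sup>2))"
      by (intro sum.cong) (auto simp: power2_eq_square algebra_simps)
    also have "\<dots> = (\<Sum>i=1..<n. (y i)\<^sup>2) + c * (2 * (\<Sum>i=1..<n. y i * u i)) + c * (c * (\<Sum>i=1..<n. (u i)\<^sup>2))"
      by (simp add: sum.distrib sum_distrib_left)
    also have "\<dots> = 1" using c by (simp add: algebra_simps)
    finally show thesis
      using that[of "\<lambda>i. y i + c * u i" 0] y0 u0 ky ku
      by (simp add: distrib_left sum.distrib mult.left_commute[of _ c] sum_distrib_left[symmetric])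
  qed
qed

section \<open>Null frames and alignment\<close>

declare One_nat_def [simp del]

lemma bilinear_linear_left: "bilinear h \<Longrightarrow> linear (\<lambda>u. h u v)"
  and bilinear_linear_right: "bilinear h \<Longrightarrow> linear (h u)"
  by (simp_all add: bilinear_def)

lemma ordered_basis_expand:
  fixes e :: "nat \<Rightarrow> 'v::real_vector"
  assumes "ordered_basis N e"
  obtains a where "v = (\<Sum>i<N. a i *\<^sub>R e i)"
proof -
  have "v \<in> range (\<lambda>u. \<Sum>x\<in>e ` {..<N}. u x *\<^sub>R x)"
    using assms by (simp add: ordered_basis_def span_finite[symmetric])
  then obtain u where "v = (\<Sum>x\<in>e ` {..<N}. u x *\<^sub>R x)" by auto
  then have "v = (\<Sum>i<N. u (e i) *\<^sub>R e i)"
    using assms by (simp add: ordered_basis_def sum.reindex)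
  then show thesis by (rule that)
qed

lemma bilinear_sum_left:
  "bilinear h \<Longrightarrow> h (\<Sum>i\<in>A. a i *\<^sub>R e i) v = (\<Sum>i\<in>A. a i * h (e i) v :: real)"
  by (simp add: linear_sum[OF bilinear_linear_left] linear_scale[OF bilinear_linear_left])

lemma bilinear_sum_right:
  "bilinear h \<Longrightarrow> h v (\<Sum>i\<in>A. a i *\<^sub>R e i) = (\<Sum>i\<in>A. a i * h v (e i) :: real)"
  by (simp add: linear_sum[OF bilinear_linear_right] linear_scale[OF bilinear_linear_right])

lemma linear_eq_on_ordered_basis:
  assumes "ordered_basis N e" "linear f" "linear g" "\<And>i. i < N \<Longrightarrow> f (e i) = g (e i)"
  shows "f v = g v"
  by (rule linear_eq_on[OF assms(2,3), of v "e ` {..<N}"])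
    (use assms in \<open>auto simp: ordered_basis_def\<close>)

text \<open>Pairing a linear relation with \<open>d j\<close> isolates its \<open>j\<close>-th
  coefficient.\<close>

lemma ordered_basis_if_dual_family:
  fixes m :: "nat \<Rightarrow> 'v::real_vector"
  assumes B: "bilinear h" and sp: "span (m ` {..<N}) = UNIV"
    and dual: "\<And>i j. i < N \<Longrightarrow> j < N \<Longrightarrow> h (m i) (d j) = (if i = j then 1 else 0 :: real)"
  shows "ordered_basis N m"
proof -
  have inj: "inj_on m {..<N}"
  proof (rule inj_onI)
    fix i j assume "i \<in> {..<N}" "j \<in> {..<N}" "m i = m j"
    then show "i = j" using dual[of i j] dual[of j j] by (auto split: if_splits)
  qed
  have "independent (m ` {..<N})"
  proof
    assume "dependent (m ` {..<N})"
    then obtain u v where v: "v \<in> m ` {..<N}" "u v \<noteq> 0" and 0: "(\<Sum>v\<in>m ` {..<N}. u v *\<^sub>R v) = 0"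
      by (auto simp: real_vector.dependent_finite)
    obtain j where j: "j < N" "v = m j" using v(1) by auto
    have "0 = h (\<Sum>i<N. u (m i) *\<^sub>R m i) (d j)"
      using 0 by (simp add: sum.reindex[OF inj] bilinear_lzero[OF B])
    also have "\<dots> = (\<Sum>i<N. if i = j then u (m j) else 0)"
      unfolding bilinear_sum_left[OF B] by (intro sum.cong) (auto simp: dual j(1))
    finally show False using j v(2) by simp
  qed
  with inj sp show ?thesis by (simp add: ordered_basis_def)
qed

lemma sum_lessThan_split_0_1:
  fixes f :: "nat \<Rightarrow> 'a::comm_monoid_add"
  assumes "2 \<le> N"
  shows "(\<Sum>i<N. f i) = f 0 + (f 1 + (\<Sum>i=2..<N. f i))"
  using assms by (simp add: lessThan_atLeast0 sum.atLeast_Suc_lessThan numeral_2_eq_2 One_nat_def)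

lemma null_frameI:
  fixes m :: "nat \<Rightarrow> 'v::real_vector"
  assumes B: "bilinear \<eta>" and sp: "span (m ` {..<N}) = UNIV"
    and gram: "\<And>A B. A < N \<Longrightarrow> B < N \<Longrightarrow> \<eta> (m A) (m B) =
        (if (A, B) \<in> {(0, 1), (1, 0)} \<or> (A = B \<and> 2 \<le> A) then 1 else 0)"
    and "2 \<le> N"
  shows "null_frame N \<eta> m"
proof -
  \<comment> \<open>A null frame is self-dual up to exchanging \<open>m 0\<close> and
    \<open>m 1\<close>.\<close>
  define s where "s i = (if i = 0 then 1 else if i = 1 then 0 else i)" for i :: nat
  have "ordered_basis N m"
  proof (rule ordered_basis_if_dual_family[OF B sp, where d = "m \<circ> s"])
    show "\<eta> (m i) ((m \<circ> s) j) = (if i = j then 1 else 0)" if "i < N" "j < N" for i j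
      using that \<open>2 \<le> N\<close> by (auto simp: s_def gram)
  qed
  then show ?thesis using gram by (simp add: null_frame_def)
qed

context
  fixes N :: nat and \<eta> :: "'v::real_vector \<Rightarrow> 'v \<Rightarrow> real" and m :: "nat \<Rightarrow> 'v"
  assumes B: "bilinear \<eta>" and sym: "\<And>u v. \<eta> u v = \<eta> v u" and N: "2 \<le> N"
    and frame: "null_frame N \<eta> m"
begin

lemma null_frame_gram:
  "\<eta> (m 0) (m 0) = 0" "\<eta> (m 1) (m 1) = 0" "\<eta> (m 0) (m 1) = 1" "\<eta> (m 1) (m 0) = 1"
  "2 \<le> i \<Longrightarrow> i < N \<Longrightarrow> \<eta> (m 0) (m i) = 0" "2 \<le> i \<Longrightarrow> i < N \<Longrightarrow> \<eta> (m 1) (m i) = 0"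
  "2 \<le> i \<Longrightarrow> i < N \<Longrightarrow> \<eta> (m i) (m 0) = 0" "2 \<le> i \<Longrightarrow> i < N \<Longrightarrow> \<eta> (m i) (m 1) = 0"
  "2 \<le> i \<Longrightarrow> i < N \<Longrightarrow> 2 \<le> j \<Longrightarrow> j < N \<Longrightarrow> \<eta> (m i) (m j) = (if i = j then 1 else 0)"
  using frame N by (auto simp: null_frame_def)

lemma null_frame_inner:
  "\<eta> (a *\<^sub>R m 0 + b *\<^sub>R m 1 + (\<Sum>i=2..<N. z i *\<^sub>R m i)) (m 0) = b"
  "\<eta> (a *\<^sub>R m 0 + b *\<^sub>R m 1 + (\<Sum>i=2..<N. z i *\<^sub>R m i)) (m 1) = a"
  "2 \<le> j \<Longrightarrow> j < N \<Longrightarrow> \<eta> (a *\<^sub>R m 0 + b *\<^sub>R m 1 + (\<Sum>i=2..<N. z i *\<^sub>R m i)) (m j) = z j"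
  by (simp_all add: bilinear_ladd[OF B] bilinear_lmul[OF B] bilinear_sum_left[OF B]
      null_frame_gram if_distrib[where f = "\<lambda>x. _ * x"] cong: if_cong)

lemma null_frame_norm:
  "\<eta> (a *\<^sub>R m 0 + b *\<^sub>R m 1 + (\<Sum>i=2..<N. z i *\<^sub>R m i))
     (a *\<^sub>R m 0 + b *\<^sub>R m 1 + (\<Sum>i=2..<N. z i *\<^sub>R m i)) = 2 * a * b + (\<Sum>i=2..<N. (z i)\<^sup>2)"
  (is "\<eta> ?v ?v = _")
proof -
  have "\<eta> ?v ?v = a * \<eta> ?v (m 0) + b * \<eta> ?v (m 1) + (\<Sum>i=2..<N. z i * \<eta> ?v (m i))"
    by (simp only: bilinear_radd[OF B] bilinear_rmul[OF B] bilinear_sum_right[OF B] real_scaleR_def)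
  also have "\<dots> = a * b + b * a + (\<Sum>i=2..<N. z i * z i)"
    by (simp add: null_frame_inner)
  finally show ?thesis by (simp add: power2_eq_square)
qed

lemma null_frame_expand:
  obtains a b z where "v = a *\<^sub>R m 0 + b *\<^sub>R m 1 + (\<Sum>i=2..<N. z i *\<^sub>R m i)"
proof -
  obtain a where "v = (\<Sum>i<N. a i *\<^sub>R m i)"
    using ordered_basis_expand frame unfolding null_frame_def by blast
  then show thesis using that[of "a 0" "a 1" a] by (simp add: sum_lessThan_split_0_1[OF N] add.assoc)
qed

text \<open>Orthogonality to \<open>m 0\<close> removes the \<open>m 1\<close> component; the norm
  is then the sum of squares of the space-like components.\<close>

lemma null_orthogonal_imp_parallel:
  assumes "\<eta> k k = 0" "\<eta> k (m 0) = 0"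
  obtains a where "k = a *\<^sub>R m 0"
proof -
  obtain a b z where k: "k = a *\<^sub>R m 0 + b *\<^sub>R m 1 + (\<Sum>i=2..<N. z i *\<^sub>R m i)"
    by (rule null_frame_expand)
  have b: "b = 0" using assms(2) unfolding k null_frame_inner .
  then have "(\<Sum>i=2..<N. (z i)\<^sup>2) = 0" using assms(1) unfolding k null_frame_norm by simp
  then have "\<forall>i\<in>{2..<N}. (z i)\<^sup>2 = 0" by (subst (asm) sum_nonneg_eq_0_iff) auto
  then have "k = a *\<^sub>R m 0" using b by (simp add: k)
  then show thesis by (rule that)
qed

text \<open>If \<open>k\<close> is not parallel to \<open>m 0\<close>, the reflection along \<open>k - m 0\<close> maps \<open>m 0\<close> to \<open>k\<close>.\<close>
lemma null_frame_along:
  assumes "k \<noteq> 0" "\<eta> k k = 0"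
  obtains m' where "null_frame N \<eta> m'" "m' 0 \<in> span {k}"
proof (cases "\<eta> k (m 0) = 0")
  case True
  then obtain a where a: "k = a *\<^sub>R m 0" using null_orthogonal_imp_parallel assms(2) by blast
  then have "m 0 = inverse a *\<^sub>R k" using assms(1) by auto
  then show thesis using that[OF frame] by (metis span_base span_scale singletonI)
next
  case False
  define h where "h = \<eta> k (m 0)"
  define w where "w = k - m 0"
  \<comment> \<open>By \<open>ww\<close> below this is
    \<open>u - (2 * \<eta> u w / \<eta> w w) *\<^sub>R w\<close>, the reflection along
    \<open>w\<close>.\<close>
  define R where "R u = u + (\<eta> u w / h) *\<^sub>R w" for u
  have h: "h \<noteq> 0" "\<eta> (m 0) k = h" using False sym by (auto simp: h_def)
  have ww: "\<eta> w w = - 2 * h"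
    using assms(2) h(2) by (simp add: w_def bilinear_lsub[OF B] bilinear_rsub[OF B] null_frame_gram h_def)
  have lin: "linear R"
    unfolding R_def by (intro linearI)
      (simp_all add: bilinear_ladd[OF B] bilinear_lmul[OF B] add_divide_distrib algebra_simps)
  have Rw: "\<eta> (R u) w = - \<eta> u w" for u
    using h(1) by (simp add: R_def bilinear_ladd[OF B] bilinear_lmul[OF B] ww)
  have RR: "R (R u) = u" for u
    unfolding R_def[of "R u"] Rw by (simp add: R_def)
  have iso: "\<eta> (R u) (R v) = \<eta> u v" for u v
  proof -
    have "\<eta> (R u) (R v) = \<eta> (R u) v + (\<eta> v w / h) * \<eta> (R u) w"
      by (simp add: R_def[of v] bilinear_radd[OF B] bilinear_rmul[OF B])
    also have "\<dots> = \<eta> u v"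
      unfolding Rw by (simp add: R_def bilinear_ladd[OF B] bilinear_lmul[OF B] sym[of w v])
    finally show ?thesis .
  qed
  have "R (m 0) = k"
    using h by (simp add: R_def w_def bilinear_rsub[OF B] null_frame_gram)
  moreover have "null_frame N \<eta> (R \<circ> m)"
  proof (rule null_frameI[OF B _ _ N])
    have "span (m ` {..<N}) = UNIV" using frame by (simp add: null_frame_def ordered_basis_def)
    then have "span ((R \<circ> m) ` {..<N}) = range R"
      unfolding image_comp[symmetric] linear_span_image[OF lin] by simp
    also have "\<dots> = UNIV" using RR by (metis surjI)
    finally show "span ((R \<circ> m) ` {..<N}) = UNIV" .
  qed (use frame in \<open>simp add: iso null_frame_def\<close>)
  ultimately show thesis using that[of "R \<circ> m"] by (simp add: span_base)
qed

end

text \<open>For a Lorentz form and a bilinear \<open>K\<close>, the last condition is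
  \<open>raise_first \<eta> K k = c *\<^sub>R k\<close> paired with every \<open>u\<close>; this
  form avoids the raised map.\<close>

definition null_eigenvector ::
  "('v::real_vector \<Rightarrow> 'v \<Rightarrow> real) \<Rightarrow> ('v \<Rightarrow> 'v \<Rightarrow> real) \<Rightarrow> 'v \<Rightarrow> bool" where
  "null_eigenvector \<eta> K k \<longleftrightarrow> k \<noteq> 0 \<and> \<eta> k k = 0 \<and> (\<exists>c. \<forall>u. K u k = c * \<eta> u k)"

lemma null_eigenvector_scale:
  assumes "bilinear \<eta>" "bilinear K" "null_eigenvector \<eta> K k" "a \<noteq> 0"
  shows "null_eigenvector \<eta> K (a *\<^sub>R k)"
proof -
  obtain c where "\<And>u. K u k = c * \<eta> u k" using assms(3) by (auto simp: null_eigenvector_def)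
  then have "K u (a *\<^sub>R k) = c * \<eta> u (a *\<^sub>R k)" for u
    by (simp add: bilinear_rmul[OF assms(1)] bilinear_rmul[OF assms(2)])
  then show ?thesis
    using assms(3,4) unfolding null_eigenvector_def
    by (auto simp: bilinear_rmul[OF assms(1)] bilinear_lmul[OF assms(1)])
qed

lemma ex_null_frame:
  fixes \<eta> :: "'v::real_vector \<Rightarrow> 'v \<Rightarrow> real"
  assumes L: "lorentz_form N \<eta>" and N: "2 \<le> N"
  obtains m where "null_frame N \<eta> m"
proof -
  obtain e where e: "ordered_basis N e"
    and d: "\<And>i j. i < N \<Longrightarrow> j < N \<Longrightarrow> \<eta> (e i) (e j) = (if i \<noteq> j then 0 else if i = 0 then - 1 else 1)"
    and B: "bilinear \<eta>" and sym: "\<And>u v. \<eta> u v = \<eta> v u"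
    using L unfolding lorentz_form_def by blast
  \<comment> \<open>Light-cone combinations of the time-like \<open>e 0\<close> and the space-like
    \<open>e 1\<close>; the factor 1/2 makes their product 1.\<close>
  define f where "f i = (if i = 0 then e 1 + e 0 else if i = 1 then (1 / 2) *\<^sub>R (e 1 - e 0) else e i)" for i
  have "e i \<in> span (f ` {..<N})" if i: "i < N" for i
  proof -
    have f: "f j \<in> span (f ` {..<N})" if "j < N" for j using that by (intro span_base) auto
    have "f 0 \<in> span (f ` {..<N})" "f 1 \<in> span (f ` {..<N})" using f N by auto
    then have "(1 / 2) *\<^sub>R f 0 - f 1 \<in> span (f ` {..<N})" "(1 / 2) *\<^sub>R f 0 + f 1 \<in> span (f ` {..<N})"
      by (auto intro: span_scale span_diff span_add)
    moreover have "e 0 = (1 / 2) *\<^sub>R f 0 - f 1" "e 1 = (1 / 2) *\<^sub>R f 0 + f 1"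
      by (simp_all add: f_def scaleR_add_right scaleR_diff_right scaleR_left_distrib[symmetric])
    ultimately have "e 0 \<in> span (f ` {..<N})" "e 1 \<in> span (f ` {..<N})" by simp_all
    moreover have "e i \<in> span (f ` {..<N})" if "i \<noteq> 0" "i \<noteq> 1" using f[OF i] that by (simp add: f_def)
    ultimately show ?thesis by metis
  qed
  then have "span (e ` {..<N}) \<subseteq> span (f ` {..<N})" by (intro span_minimal) auto
  then have sp: "span (f ` {..<N}) = UNIV" using e by (auto simp: ordered_basis_def)
  have "null_frame N \<eta> f"
  proof (rule null_frameI[OF B sp _ N])
    fix i j assume ij: "i < N" "j < N"
    have s: "\<eta> (e 0) (e 0) = - 1" "\<eta> (e 1) (e 1) = 1" "\<eta> (e 0) (e 1) = 0" "\<eta> (e 1) (e 0) = 0"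
      using d[of 0 0] d[of 1 1] d[of 0 1] d[of 1 0] N by auto
    have s': "\<eta> (e l) (e i) = 0" "\<eta> (e i) (e l) = 0" if "l < 2" "i < N" "2 \<le> i" for i l
      using d[of l i] d[of i l] that by auto
    show "\<eta> (f i) (f j) = (if (i, j) \<in> {(0, 1), (1, 0)} \<or> (i = j \<and> 2 \<le> i) then 1 else 0)"
    proof (cases "i < 2"; cases "j < 2")
      assume "i < 2" "j < 2"
      then have "i = 0 \<or> i = 1" "j = 0 \<or> j = 1" by auto
      then show ?thesis
        by (auto simp: f_def s bilinear_ladd[OF B] bilinear_radd[OF B] bilinear_lmul[OF B]
            bilinear_rmul[OF B] bilinear_lsub[OF B] bilinear_rsub[OF B])
    next
      assume "i < 2" "\<not> j < 2"
      then show ?thesis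
        using s'[of 0 j] s'[of 1 j] ij
        by (auto simp: f_def bilinear_ladd[OF B] bilinear_lmul[OF B] bilinear_lsub[OF B])
    next
      assume "\<not> i < 2" "j < 2"
      then show ?thesis
        using s'[of 0 i] s'[of 1 i] ij
        by (auto simp: f_def bilinear_radd[OF B] bilinear_rmul[OF B] bilinear_rsub[OF B])
    next
      assume "\<not> i < 2" "\<not> j < 2"
      then show ?thesis using ij by (simp add: f_def d)
    qed
  qed
  then show thesis by (rule that)
qed

lemma bivector_self: "bivector K \<Longrightarrow> K u u = 0"
  unfolding bivector_def by (metis equal_neg_zero)

text \<open>In a frame along \<open>k\<close>, both \<open>K _ (m 0)\<close> and
  \<open>\<eta> _ (m 0)\<close> vanish on \<open>m 0\<close>, and alignment makes the former vanish
  on the space-like vectors, as the latter does. Only the value on \<open>m 1\<close> remains, which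
  is the eigenvalue.\<close>

lemma aligned_iff_null_eigenvector:
  fixes \<eta> K :: "'v::real_vector \<Rightarrow> 'v \<Rightarrow> real"
  assumes L: "lorentz_form N \<eta>" and K: "bivector K" and N: "2 \<le> N"
    and k: "k \<noteq> 0" "\<eta> k k = 0"
  shows "aligned N \<eta> K (span {k}) \<longleftrightarrow> null_eigenvector \<eta> K k"
proof -
  have B: "bilinear \<eta>" and sym: "\<And>u v. \<eta> u v = \<eta> v u" using L unfolding lorentz_form_def by blast+
  have BK: "bilinear K" and skew: "\<And>u v. K u v = - K v u" using K unfolding bivector_def by blast+
  show ?thesis
  proof
    assume "aligned N \<eta> K (span {k})"
    then obtain m where m: "null_frame N \<eta> m" "m 0 \<in> span {k}" "\<And>i. i \<in> {2..<N} \<Longrightarrow> K (m 0) (m i) = 0"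
      by (auto simp: aligned_def)
    note gram = null_frame_gram[OF B sym N m(1)]
    obtain a where a: "m 0 = a *\<^sub>R k" using m(2) by (auto simp: span_singleton)
    have "\<eta> (m 0) (m 1) = 1" by (rule gram)
    then have "a \<noteq> 0" by (auto simp: a bilinear_lzero[OF B])
    have "K u (m 0) = K (m 1) (m 0) * \<eta> u (m 0)" for u
    proof (rule linear_eq_on_ordered_basis[of N m "\<lambda>u. K u (m 0)" "\<lambda>u. K (m 1) (m 0) * \<eta> u (m 0)"])
      show "ordered_basis N m" using m(1) by (simp add: null_frame_def)
      show "linear (\<lambda>u. K u (m 0))" by (rule bilinear_linear_left[OF BK])
      show "linear (\<lambda>u. K (m 1) (m 0) * \<eta> u (m 0))"
        using linear_compose_scale_right[OF bilinear_linear_left[OF B], of "K (m 1) (m 0)"] by simp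
      show "K (m i) (m 0) = K (m 1) (m 0) * \<eta> (m i) (m 0)" if "i < N" for i
      proof -
        consider "i = 0" | "i = 1" | "2 \<le> i" by linarith
        then show ?thesis
        proof cases
          case 3
          then show ?thesis using m(3)[of i] skew[of "m i"] gram(7)[of i] that by simp
        qed (simp_all add: bivector_self[OF K] gram)
      qed
    qed
    then obtain c where "\<And>u. K u (m 0) = c * \<eta> u (m 0)" by blast
    then have "K u k = c * \<eta> u k" for u
      using \<open>a \<noteq> 0\<close> by (simp add: a bilinear_rmul[OF B] bilinear_rmul[OF BK])
    then show "null_eigenvector \<eta> K k" using k unfolding null_eigenvector_def by blast
  next
    assume "null_eigenvector \<eta> K k"
    then obtain c where c: "\<And>u. K u k = c * \<eta> u k" by (auto simp: null_eigenvector_def)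
    obtain m where "null_frame N \<eta> m" using ex_null_frame[OF L N] by blast
    from null_frame_along[OF B sym N this k]
    obtain m where m: "null_frame N \<eta> m" "m 0 \<in> span {k}" .
    obtain a where a: "m 0 = a *\<^sub>R k" using m(2) by (auto simp: span_singleton)
    have "K (m 0) (m i) = 0" if "i \<in> {2..<N}" for i
    proof -
      have "K (m 0) (m i) = - K (m i) (m 0)" by (rule skew)
      also have "\<dots> = - (c * \<eta> (m i) (m 0))"
        by (simp add: a bilinear_rmul[OF B] bilinear_rmul[OF BK] c)
      finally show ?thesis using null_frame_gram(7)[OF B sym N m(1), of i] that by simp
    qed
    then show "aligned N \<eta> K (span {k})" using m unfolding aligned_def by blast
  qed
qed

text \<open>With \<open>k = k z\<close>, the polynomial is
  \<open>K k (m j) - z j * K k (m 1)\<close>, where \<open>z j = \<eta> k (m j)\<close> and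
  \<open>1 = \<eta> k (m 1)\<close>. The equations thus say that \<open>K k\<close> and
  \<open>\<eta> k\<close> are proportional on \<open>m 1\<close>, ...,
  \<open>m (N - 1)\<close>.\<close>

lemma alignment_poly_zero_iff:
  fixes \<eta> K :: "'v::real_vector \<Rightarrow> 'v \<Rightarrow> real"
  assumes B: "bilinear \<eta>" and sym: "\<And>u v. \<eta> u v = \<eta> v u" and K: "bivector K" and N: "2 \<le> N"
    and frame: "null_frame N \<eta> m"
  defines "k z \<equiv> 1 *\<^sub>R m 0 + (- (\<Sum>i=2..<N. (z i)\<^sup>2) / 2) *\<^sub>R m 1 + (\<Sum>i=2..<N. z i *\<^sub>R m i)"
  shows "(\<forall>j\<in>{2..<N}. alignment_poly N K m j z = 0) \<longleftrightarrow> null_eigenvector \<eta> K (k z)"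
proof -
  have BK: "bilinear K" and skew: "\<And>u v. K u v = - K v u" using K unfolding bivector_def by blast+
  note inner = null_frame_inner[OF B sym N frame]
  have inner_k: "\<eta> (k z) (m 1) = 1" "\<And>j. 2 \<le> j \<Longrightarrow> j < N \<Longrightarrow> \<eta> (k z) (m j) = z j"
    unfolding k_def by (simp_all only: inner)
  have "\<eta> (k z) (k z) = 0" unfolding k_def null_frame_norm[OF B sym N frame] by simp
  moreover have "k z \<noteq> 0" using inner_k(1) by (auto simp: bilinear_lzero[OF B])
  ultimately have null: "null_eigenvector \<eta> K (k z) \<longleftrightarrow> (\<exists>c. \<forall>u. K u (k z) = c * \<eta> u (k z))"
    by (simp add: null_eigenvector_def)
  have Kk: "K (k z) v = K (m 0) v - (\<Sum>i=2..<N. (z i)\<^sup>2) / 2 * K (m 1) v + (\<Sum>i=2..<N. z i * K (m i) v)" for v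
    unfolding k_def
    by (simp add: bilinear_ladd[OF BK] bilinear_lmul[OF BK] bilinear_lsub[OF BK] bilinear_sum_left[OF BK])
  have poly: "alignment_poly N K m j z = K (k z) (m j) - z j * K (k z) (m 1)" for j
    by (simp add: alignment_poly_def Kk bivector_self[OF K] power2_eq_square algebra_simps sum_distrib_left)
  show ?thesis
    unfolding null
  proof
    assume zero: "\<forall>j\<in>{2..<N}. alignment_poly N K m j z = 0"
    define c where "c = K (m 1) (k z)"
    have 1: "K (m 1) (k z) = c * \<eta> (m 1) (k z)"
      using inner_k(1) by (simp add: c_def sym[of "m 1"])
    have 2: "K (m j) (k z) = c * \<eta> (m j) (k z)" if "2 \<le> j" "j < N" for j
    proof -
      have "K (k z) (m j) = z j * K (k z) (m 1)" using zero that by (simp add: poly)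
      then show ?thesis
        using inner_k(2)[OF that] by (simp add: c_def sym[of "m j"] skew[of _ "k z"])
    qed
    define r where "r u = K u (k z) - c * \<eta> u (k z)" for u
    have r_lin: "r (u + v) = r u + r v" "r (a *\<^sub>R u) = a * r u" for u v a
      by (simp_all add: r_def bilinear_ladd[OF B] bilinear_ladd[OF BK] bilinear_lmul[OF B]
          bilinear_lmul[OF BK] algebra_simps)
    then have "linear r" by (intro linearI) simp_all
    have r: "r (m 1) = 0" "\<And>j. 2 \<le> j \<Longrightarrow> j < N \<Longrightarrow> r (m j) = 0" using 1 2 by (simp_all add: r_def)
    \<comment> \<open>The value of \<open>r\<close> on \<open>m 0\<close> is found from its value on
      \<open>k z\<close>, in which \<open>m 0\<close> has coefficient 1.\<close>
    have "r (k z) = 0"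
      using \<open>\<eta> (k z) (k z) = 0\<close> by (simp add: r_def bivector_self[OF K])
    moreover have "r (\<Sum>i=2..<N. z i *\<^sub>R m i) = 0"
      by (simp add: linear_sum[OF \<open>linear r\<close>] r_lin r)
    ultimately have "r (m 0) = 0" by (simp add: k_def r_lin r linear_diff[OF \<open>linear r\<close>])
    have "r u = 0" for u
    proof (rule linear_eq_on_ordered_basis[of N m r "\<lambda>_. 0"])
      show "ordered_basis N m" using frame by (simp add: null_frame_def)
      show "r (m i) = 0" if "i < N" for i
      proof -
        consider "i = 0" | "i = 1" | "2 \<le> i" by linarith
        then show ?thesis using r \<open>r (m 0) = 0\<close> that by cases simp_all
      qed
    qed (use \<open>linear r\<close> in \<open>auto intro: linearI\<close>)
    then show "\<exists>c. \<forall>u. K u (k z) = c * \<eta> u (k z)" by (auto simp: r_def)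
  next
    assume "\<exists>c. \<forall>u. K u (k z) = c * \<eta> u (k z)"
    then obtain c where c: "\<And>u. K u (k z) = c * \<eta> u (k z)" by blast
    have "K (k z) u = - (c * \<eta> (k z) u)" for u using skew[of "k z" u] c[of u] sym[of u] by simp
    then show "\<forall>j\<in>{2..<N}. alignment_poly N K m j z = 0"
      by (simp add: poly inner_k)
  qed
qed

text \<open>A null vector with non-zero \<open>m 0\<close> component rescales to a finite point;
  otherwise it is a multiple of \<open>m 1\<close>, the point at infinity.\<close>

lemma ex_alignment_zero_iff:
  fixes \<eta> K :: "'v::real_vector \<Rightarrow> 'v \<Rightarrow> real"
  assumes L: "lorentz_form N \<eta>" and K: "bivector K" and N: "2 \<le> N" and frame: "null_frame N \<eta> m"
  shows "(\<exists>\<zeta>. alignment_zero N \<eta> K m \<zeta>) \<longleftrightarrow> (\<exists>k. null_eigenvector \<eta> K k)"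
proof -
  have B: "bilinear \<eta>" and sym: "\<And>u v. \<eta> u v = \<eta> v u" using L unfolding lorentz_form_def by blast+
  have BK: "bilinear K" using K unfolding bivector_def by blast
  note gram = null_frame_gram[OF B sym N frame]
  have m1: "m 1 \<noteq> 0" "\<eta> (m 1) (m 1) = 0"
    using gram(2,3) bilinear_rzero[OF B, of "m 0"] by auto
  note None = aligned_iff_null_eigenvector[OF L K N m1]
  note Some = alignment_poly_zero_iff[OF B sym K N frame]
  show ?thesis
  proof
    assume "\<exists>\<zeta>. alignment_zero N \<eta> K m \<zeta>"
    then show "\<exists>k. null_eigenvector \<eta> K k"
      using None Some by (auto simp: alignment_zero_def split: option.splits)
  next
    assume "\<exists>k. null_eigenvector \<eta> K k"
    then obtain k where k: "null_eigenvector \<eta> K k" ..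
    obtain a b z where abz: "k = a *\<^sub>R m 0 + b *\<^sub>R m 1 + (\<Sum>i=2..<N. z i *\<^sub>R m i)"
      by (rule null_frame_expand[OF B sym N frame])
    have null: "2 * a * b + (\<Sum>i=2..<N. (z i)\<^sup>2) = 0"
      using k null_frame_norm[OF B sym N frame, of a b z] by (simp add: null_eigenvector_def abz)
    show "\<exists>\<zeta>. alignment_zero N \<eta> K m \<zeta>"
    proof (cases "a = 0")
      case True
      then have "(\<Sum>i=2..<N. (z i)\<^sup>2) = 0" using null by simp
      then have "\<forall>i\<in>{2..<N}. (z i)\<^sup>2 = 0" by (subst (asm) sum_nonneg_eq_0_iff) auto
      then have kb: "k = b *\<^sub>R m 1" using True by (simp add: abz)
      then have "b \<noteq> 0" using k by (auto simp: null_eigenvector_def)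
      then have "null_eigenvector \<eta> K (m 1)"
        using null_eigenvector_scale[OF B BK k, of "inverse b"] by (simp add: kb)
      then show ?thesis using None by (intro exI[of _ None]) (simp add: alignment_zero_def)
    next
      case False
      define z' where "z' i = z i / a" for i
      have ba: "b / a = - (\<Sum>i=2..<N. (z' i)\<^sup>2) / 2"
        using null False
        by (simp add: z'_def power_divide sum_divide_distrib[symmetric] field_simps power2_eq_square)
      have "inverse a *\<^sub>R k = 1 *\<^sub>R m 0 + (b / a) *\<^sub>R m 1 + (\<Sum>i=2..<N. z' i *\<^sub>R m i)"
        using False by (simp add: abz scaleR_add_right scaleR_sum_right z'_def divide_inverse_commute)
      then have "inverse a *\<^sub>R k =
          1 *\<^sub>R m 0 + (- (\<Sum>i=2..<N. (z' i)\<^sup>2) / 2) *\<^sub>R m 1 + (\<Sum>i=2..<N. z' i *\<^sub>R m i)"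
        unfolding ba .
      then have "\<forall>j\<in>{2..<N}. alignment_poly N K m j z' = 0"
        using null_eigenvector_scale[OF B BK k, of "inverse a"] False unfolding Some by simp
      then show ?thesis by (intro exI[of _ "Some z'"]) (simp add: alignment_zero_def)
    qed
  qed
qed

section \<open>The characteristic polynomial in an orthonormal basis\<close>

lemma matrix_in_orthonormal_basis:
  fixes \<eta> K :: "'v::real_vector \<Rightarrow> 'v \<Rightarrow> real"
  assumes L: "lorentz_form N \<eta>" and BK: "bilinear K" and e: "ordered_basis N e"
    and d: "\<And>i j. i < N \<Longrightarrow> j < N \<Longrightarrow> \<eta> (e i) (e j) = (if i \<noteq> j then 0 else if i = 0 then - 1 else 1)"
  shows "matrix_in_basis N e (raise_first \<eta> K) = mat N N (\<lambda>(i, j). msign i * K (e i) (e j))"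
proof (rule eq_matI)
  have B: "bilinear \<eta>" using L by (simp add: lorentz_form_def)
  have inj: "inj_on e {..<N}" and sp: "independent (e ` {..<N})" "span (e ` {..<N}) = UNIV"
    using e by (auto simp: ordered_basis_def)
  fix i j assume "i < dim_row (mat N N (\<lambda>(i, j). msign i * K (e i) (e j)))"
    "j < dim_col (mat N N (\<lambda>(i, j). msign i * K (e i) (e j)))"
  then have ij: "i < N" "j < N" by auto
  define x where "x = raise_first \<eta> K (e j)"
  define a where "a i = representation (e ` {..<N}) x (e i)" for i
  have "x = (\<Sum>y\<in>e ` {..<N}. representation (e ` {..<N}) x y *\<^sub>R y)"
    by (rule real_vector.sum_representation_eq[symmetric]) (use sp in auto)
  then have "x = (\<Sum>i<N. a i *\<^sub>R e i)" by (simp add: sum.reindex[OF inj] a_def)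
  then have "\<eta> (e i) x = (\<Sum>l<N. a l * \<eta> (e i) (e l))" by (metis bilinear_sum_right[OF B])
  also have "\<dots> = (\<Sum>l<N. if l = i then msign i * a i else 0)"
    by (intro sum.cong) (use ij in \<open>auto simp: d msign_def\<close>)
  \<comment> \<open>\<open>\<eta> (e i) x\<close> is the \<open>i\<close>-th coordinate of
    \<open>x\<close> up to \<open>msign\<close>, and it equals \<open>K (e i) (e j)\<close> because
    \<open>x\<close> is the raised image of \<open>e j\<close>.\<close>
  finally have "K (e i) (e j) = msign i * a i"
    using ij raise_first[OF L BK, of "e i" "e j"] by (simp add: x_def)
  then have "a i = msign i * K (e i) (e j)" by (simp add: msign_def)
  then show "matrix_in_basis N e (raise_first \<eta> K) $$ (i, j) = mat N N (\<lambda>(i, j). msign i * K (e i) (e j)) $$ (i, j)"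
    using ij by (simp add: matrix_in_basis_def a_def x_def)
qed (simp_all add: matrix_in_basis_def)

text \<open>Negating row 0 turns \<open>t - T\<close> into the Gram matrix of
  \<open>t \<eta> - K\<close>.\<close>

lemma poly_char_poly_msign:
  assumes "0 < n"
  shows "poly (char_poly (mat n n (\<lambda>(i, j). msign i * k i j))) t = - fdet n (pencil k (- t) t)"
proof -
  define f where "f i j = (if i = j then t else 0) - msign i * k i j" for i j
  have "fdet n (pencil k (- t) t) = fdet n (\<lambda>i j. if i = 0 then - 1 * f i j else f i j)"
    by (intro fdet_cong) (auto simp: f_def pencil_def msign_def)
  also have "\<dots> = - fdet n f" using fdet_scale_row[OF assms, of "- 1" f] by simp
  finally show ?thesis by (simp add: poly_char_poly_fdet f_def[abs_def])
qed

text \<open>Transposing and negating give the same matrix, and negation contributes the sign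
  \<open>(- 1) ^ n\<close>.\<close>

lemma fdet_skew_odd:
  assumes skew: "\<And>i j. i < n \<Longrightarrow> j < n \<Longrightarrow> k i j = - k j i" and "odd n"
  shows "fdet n k = 0"
proof -
  have "fdet n k = fdet n (\<lambda>i j. - k j i)" by (rule fdet_cong) (rule skew)
  also have "\<dots> = - fdet n k"
    unfolding fdet_uminus[of n "\<lambda>i j. k j i"] fdet_transpose[of n k] using \<open>odd n\<close> by simp
  finally show ?thesis by simp
qed

text \<open>Translation to coordinates in an orthonormal basis, where null eigenvectors are
  normalised to \<open>v 0 = 1\<close>.\<close>

lemma ex_null_eigenvector_iff:
  fixes \<eta> K :: "'v::real_vector \<Rightarrow> 'v \<Rightarrow> real"
  assumes L: "lorentz_form N \<eta>" and K: "bivector K" and "odd N"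
  shows "(\<exists>k. null_eigenvector \<eta> K k) \<longleftrightarrow> char_sigma N (raise_first \<eta> K) (N - 1) \<le> 0"
proof -
  obtain e where e: "ordered_basis N e"
    and d: "\<And>i j. i < N \<Longrightarrow> j < N \<Longrightarrow> \<eta> (e i) (e j) = (if i \<noteq> j then 0 else if i = 0 then - 1 else 1)"
    and B: "bilinear \<eta>" and sym: "\<And>u v. \<eta> u v = \<eta> v u"
    using L unfolding lorentz_form_def by blast
  have BK: "bilinear K" and skewK: "\<And>u v. K u v = - K v u" using K unfolding bivector_def by blast+
  have "0 < N" using \<open>odd N\<close> by (rule odd_pos)
  define k where "k i j = K (e i) (e j)" for i j
  have skew: "k i j = - k j i" if "i < N" "j < N" for i j unfolding k_def by (rule skewK)
  define p where "p = char_poly (mat N N (\<lambda>(i, j). msign i * k i j))"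
  have p: "poly p t = - fdet N (pencil k (- t) t)" for t
    unfolding p_def by (rule poly_char_poly_msign) fact
  have "fdet N (pencil k 0 0) = fdet N (\<lambda>i j. - k i j)" by (rule fdet_cong) (simp add: pencil_def)
  also have "\<dots> = 0" using fdet_skew_odd[of N k, OF skew \<open>odd N\<close>] by (simp add: fdet_uminus)
  finally have p0: "coeff p 0 = 0" using p[of 0] by (simp add: poly_0_coeff_0)
  have "char_poly_lin N (raise_first \<eta> K) = p"
    using char_poly_lin_eq[OF e linear_raise_first[OF L BK]] matrix_in_orthonormal_basis[OF L BK e d]
    by (simp add: p_def k_def)
  \<comment> \<open>\<open>N - 1\<close> is even and \<open>N - (N - 1) = 1\<close>, so this is the
    linear coefficient with sign +1.\<close>
  then have sigma: "char_sigma N (raise_first \<eta> K) (N - 1) = coeff p 1"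
    using \<open>odd N\<close> \<open>0 < N\<close> by (simp add: char_sigma_def)
  have \<eta>e: "\<eta> (e i) (\<Sum>j<N. v j *\<^sub>R e j) = msign i * v i" if "i < N" for i v
  proof -
    have "\<eta> (e i) (\<Sum>j<N. v j *\<^sub>R e j) = (\<Sum>j<N. if j = i then msign i * v i else 0)"
      unfolding bilinear_sum_right[OF B] by (intro sum.cong) (use that in \<open>auto simp: d msign_def\<close>)
    then show ?thesis using that by simp
  qed
  have norm: "\<eta> (\<Sum>j<N. v j *\<^sub>R e j) (\<Sum>j<N. v j *\<^sub>R e j) = (\<Sum>i<N. v i * (msign i * v i))" for v
    unfolding bilinear_sum_left[OF B] by (intro sum.cong) (auto simp: \<eta>e)
  have Ke: "K (e i) (\<Sum>j<N. v j *\<^sub>R e j) = (\<Sum>j<N. k i j * v j)" for i v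
    by (simp add: bilinear_sum_right[OF BK] k_def mult.commute)
  show ?thesis
    unfolding sigma
  proof
    assume "\<exists>x. null_eigenvector \<eta> K x"
    then obtain x c where x: "x \<noteq> 0" "\<eta> x x = 0" "\<And>u. K u x = c * \<eta> u x"
      by (auto simp: null_eigenvector_def)
    obtain v where v: "x = (\<Sum>j<N. v j *\<^sub>R e j)" using ordered_basis_expand[OF e] by blast
    have "\<exists>i<N. v i \<noteq> 0"
    proof (rule ccontr)
      assume "\<not> ?thesis"
      then have "x = 0" unfolding v by (intro sum.neutral) auto
      with x(1) show False ..
    qed
    moreover have "(\<Sum>i<N. v i * (msign i * v i)) = 0" using x(2) by (simp add: v norm)
    ultimately have n: "v 0 \<noteq> 0" "(\<Sum>i=1..<N. (v i / v 0)\<^sup>2) = 1"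
      using minkowski_null_normalize[OF \<open>0 < N\<close>, of v] by blast+
    have eig: "(\<Sum>j<N. k i j * v j) = c * (msign i * v i)" if "i < N" for i
      using x(3)[of "e i"] by (simp add: v Ke \<eta>e[OF that])
    show "coeff p 1 \<le> 0"
    proof (rule sigma_le_0_if_null_eigenvector[of N k p "\<lambda>i. v i / v 0" c, OF skew \<open>0 < N\<close> p p0])
      show "(\<Sum>j<N. k i j * (v j / v 0)) = c * (msign i * (v i / v 0))" if "i < N" for i
        using eig[OF that] by (simp add: sum_divide_distrib[symmetric])
    qed (use n in auto)
  next
    assume "coeff p 1 \<le> 0"
    moreover have "lead_coeff p = 1" unfolding p_def by (rule char_poly_fdet_monic)
    ultimately obtain v c where v: "v 0 = 1" "(\<Sum>i=1..<N. (v i)\<^sup>2) = 1"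
      and eig: "\<And>i. i < N \<Longrightarrow> (\<Sum>j<N. k i j * v j) = c * (msign i * v i)"
      using null_eigenvector_if_sigma_le_0[of N k p, OF skew \<open>0 < N\<close> p p0] by blast
    define x where "x = (\<Sum>j<N. v j *\<^sub>R e j)"
    have "\<eta> x x = 0"
      using v by (simp add: x_def norm sum_lessThan_split_0[OF \<open>0 < N\<close>] msign_def power2_eq_square)
    moreover have "\<eta> (e 0) x = - 1" using v(1) by (simp add: x_def \<eta>e \<open>0 < N\<close> msign_def)
    then have "x \<noteq> 0" by (auto simp: bilinear_rzero[OF B])
    moreover have "K u x = c * \<eta> u x" for u
    proof (rule linear_eq_on_ordered_basis[OF e, of "\<lambda>u. K u x" "\<lambda>u. c * \<eta> u x"])
      show "linear (\<lambda>u. K u x)" by (rule bilinear_linear_left[OF BK])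
      show "linear (\<lambda>u. c * \<eta> u x)"
        using linear_compose_scale_right[OF bilinear_linear_left[OF B], of c] by simp
      show "K (e i) x = c * \<eta> (e i) x" if "i < N" for i
        using eig[OF that] by (simp add: x_def Ke \<eta>e[OF that])
    qed
    ultimately show "\<exists>x. null_eigenvector \<eta> K x" unfolding null_eigenvector_def by blast
  qed
qed

theorem proposition4p5:
  fixes \<eta> K :: "'v::real_vector \<Rightarrow> 'v \<Rightarrow> real" and N :: nat
  assumes "3 \<le> N" and "odd N"
    and "dim (UNIV :: 'v set) = N"
    and "lorentz_form N \<eta>"
    and "bivector K"
  shows "((\<exists>k. k \<noteq> 0 \<and> \<eta> k k = 0 \<and> aligned N \<eta> K (span {k}))
            \<longleftrightarrow> char_sigma N (raise_first \<eta> K) (N - 1) \<le> 0)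
       \<and> (\<forall>m. null_frame N \<eta> m \<longrightarrow>
            ((\<exists>\<zeta>. alignment_zero N \<eta> K m \<zeta>)
               \<longleftrightarrow> char_sigma N (raise_first \<eta> K) (N - 1) \<le> 0))"
proof -
  have N: "2 \<le> N" using assms(1) by simp
  have "(\<exists>k. k \<noteq> 0 \<and> \<eta> k k = 0 \<and> aligned N \<eta> K (span {k})) \<longleftrightarrow> (\<exists>k. null_eigenvector \<eta> K k)"
    using aligned_iff_null_eigenvector[OF assms(4,5) N] unfolding null_eigenvector_def by blast
  then show ?thesis
    using ex_null_eigenvector_iff[OF assms(4,5,2)] ex_alignment_zero_iff[OF assms(4,5) N] by blast
qed

end
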